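(* Let $\sigma$ be an admissible weight on $\mathbb{D}$, let $\alpha>-1$, $0<p<\infty$, $t>\frac{2}{\alpha+2}$, and let $\Omega$ be the positive measure $d\Omega=\sigma\,dA$. Let $\psi\in\mathcal{H}(\mathbb{D})$, let $\varphi$ be an analytic self-map of $\mathbb{D}$, and suppose that the weighted composition operator $C_{\psi,\varphi}:A^p_\sigma\to L^p(\Omega)$ is bounded. Then the following statements are equivalent: (a) $C_{\psi,\varphi}$ is power compact, that is, $C^n_{\psi,\varphi}$ is compact for some $n\in\mathbb{N}$. (b) For some $n\in\mathbb{N}$, $\dfrac{\widetilde{\Omega}_{n,t}(z)}{\sigma(z)(1-|z|^{2})^{2-\frac{(\alpha+2)t}{2}}}\to 0$ as $z\to\partial\mathbb{D}$. (c) For some $n\in\mathbb{N}$ and for some (equivalently, for any) $R\in(0,1)$, $\dfrac{\widehat{\Omega}_{n,R}(z)}{\sigma(z)}\to 0$ as $z\to\partial\mathbb{D}$. (d) For some $n\in\mathbb{N}$ and for some (equivalently, for any) $r$-lattice $\{z_k\}_{k=1}^{\infty}$ with $r\in(0,1)$, $\dfrac{\widehat{\Omega}_{n,r}(z_{k})}{\sigma(z_k)}\to 0$ as $k\to\infty$.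
   Context: $\mathbb{D}=\{z\in\mathbb{C}:|z|<1\}$, $\mathcal{H}(\mathbb{D})$ is the space of analytic functions on $\mathbb{D}$, and $dA=\frac{dx\,dy}{\pi}$ is normalized area measure; $z\to\partial\mathbb{D}$ means $|z|\to1$. A weight is a positive integrable function $\sigma\in C^2[0,1]$, extended to $\mathbb{D}$ by $\sigma(z)=\sigma(|z|)$. It is admissible if $\sigma$ is non-increasing on $[0,1)$ and $\sigma(r)(1-r)^{-(1+\delta)}$ is non-decreasing on $[0,1)$ for some $\delta>0$. For $0<p<\infty$, $A^p_\sigma=\{f\in\mathcal{H}(\mathbb{D}):\|f\|^p_{A^p_\sigma}=\int_{\mathbb{D}}|f|^p\sigma\,dA<\infty\}$. $C_{\psi,\varphi}f=\psi\,(f\circ\varphi)$. Let $\varphi_n$ denote the $n$-th iterate of $\varphi$ ($\varphi_0$ the identity). Then $C^n_{\psi,\varphi}f=\langle\psi,\varphi,n\rangle\, f\circ\varphi_n$ with $\langle\psi,\varphi,n\rangle=\prod_{j=0}^{n-1}\psi\circ\varphi_j$. Since $C_{\psi,\varphi}f$ is analytic and $d\Omega=\sigma\,dA$, the powers $C^n_{\psi,\varphi}$ act on $A^p_\sigma$. Define the measure $\Omega_n$ on $\mathbb{D}$ by $\Omega_n(B)=\int_{\varphi_n^{-1}(B)}|\langle\psi,\varphi,n\rangle|^p\,d\Omega$ for Borel sets $B\subset\mathbb{D}$, so that $\|C^n_{\psi,\varphi}f\|^p_{L^p(\Omega)}=\int_{\mathbb{D}}|f|^p\,d\Omega_n$.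 Here $\mathbb{N}=\{1,2,\dots\}$. For $a\in\mathbb{D}$ and $r\in(0,1)$, $E(a,r)=\{z\in\mathbb{D}:|\frac{a-z}{1-\bar a z}|<r\}$ is the pseudohyperbolic disk and $|E(a,r)|$ is its area. A sequence $\{z_k\}_{k=1}^\infty\subset\mathbb{D}$ is an $r$-lattice if the disks $E(z_k,r)$ cover $\mathbb{D}$ and there is an integer $M>0$ such that each $z\in\mathbb{D}$ belongs to at most $M$ of the disks $E(z_k,\frac{1+r}{2})$. For $\alpha>-1$, $K^\alpha(z,w)=(1-\bar w z)^{-(\alpha+2)}$, $k^\alpha_z(w)=K^\alpha(z,w)/\sqrt{K^\alpha(z,z)}$, $\widetilde{\Omega}_{n,t}(z)=\int_{\mathbb{D}}|k^\alpha_z(w)|^t\,d\Omega_n(w)$, and $\widehat{\Omega}_{n,r}(z)=\Omega_n(E(z,r))/|E(z,r)|$. *)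

theory Defs
  imports "HOL-Complex_Analysis.Complex_Analysis"
begin

abbreviation unit_disc :: "complex set" where
  "unit_disc \<equiv> ball 0 1"

definition dA :: "complex measure" where
  "dA = density (restrict_space lborel unit_disc) (\<lambda>_. ennreal (1 / pi))"

definition to_unit_circle :: "complex filter" where
  "to_unit_circle = filtercomap cmod (at_left 1)"

text \<open>Derivatives at the endpoints of the closed unit interval are one-sided.\<close>

definition C2_unit_interval :: "(real \<Rightarrow> real) \<Rightarrow> bool" where
  "C2_unit_interval \<sigma> \<longleftrightarrow> (\<exists>\<sigma>' \<sigma>''.
     (\<forall>x\<in>{0..1}. (\<sigma> has_real_derivative \<sigma>' x) (at x within {0..1})) \<and>
     (\<forall>x\<in>{0..1}. (\<sigma>' has_real_derivative \<sigma>'' x) (at x within {0..1})) \<and>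
     continuous_on {0..1} \<sigma>'')"

text \<open>A weight is a positive function on the closed interval, so it is positive at 1 as
  well. The radial extension to the disc is written \<open>\<sigma> (cmod z)\<close>.\<close>

definition weight :: "(real \<Rightarrow> real) \<Rightarrow> bool" where
  "weight \<sigma> \<longleftrightarrow> (\<forall>x\<in>{0..1}. 0 < \<sigma> x) \<and> C2_unit_interval \<sigma> \<and>
     set_integrable lborel {0..1} \<sigma>"

definition admissible_weight :: "(real \<Rightarrow> real) \<Rightarrow> bool" where
  "admissible_weight \<sigma> \<longleftrightarrow> weight \<sigma> \<and> antimono_on {0..<1} \<sigma> \<and>
     (\<exists>\<delta>>0. mono_on {0..<1} (\<lambda>r. \<sigma> r * (1 - r) powr (- (1 + \<delta>))))"

definition Omega :: "(real \<Rightarrow> real) \<Rightarrow> complex measure" where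
  "Omega \<sigma> = density dA (\<lambda>z. ennreal (\<sigma> (cmod z)))"

text \<open>Elements of L^p are represented by functions, not by classes modulo null sets; for
  \<open>p < 1\<close>, \<open>Lp_norm\<close> is a quasi-norm.\<close>

definition Lp_space :: "real \<Rightarrow> 'a measure \<Rightarrow> ('a \<Rightarrow> complex) set" where
  "Lp_space p M = {f \<in> borel_measurable M. integrable M (\<lambda>x. cmod (f x) powr p)}"

definition Lp_norm :: "real \<Rightarrow> 'a measure \<Rightarrow> ('a \<Rightarrow> complex) \<Rightarrow> real" where
  "Lp_norm p M f = (\<integral>x. cmod (f x) powr p \<partial>M) powr (1 / p)"

definition bergman_space :: "real \<Rightarrow> (real \<Rightarrow> real) \<Rightarrow> (complex \<Rightarrow> complex) set" where
  "bergman_space p \<sigma> = {f \<in> Lp_space p (Omega \<sigma>). f holomorphic_on unit_disc}"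

text \<open>Boundedness and compactness of an operator \<open>T\<close> from a subspace \<open>X\<close> of L^p, carrying the
  (quasi-)norm of L^p, into L^p.\<close>

definition Lp_bounded_operator ::
  "real \<Rightarrow> 'a measure \<Rightarrow> ('a \<Rightarrow> complex) set \<Rightarrow> (('a \<Rightarrow> complex) \<Rightarrow> ('a \<Rightarrow> complex)) \<Rightarrow> bool" where
  "Lp_bounded_operator p M X T \<longleftrightarrow> (\<forall>f\<in>X. T f \<in> Lp_space p M) \<and>
     (\<exists>C. \<forall>f\<in>X. Lp_norm p M (T f) \<le> C * Lp_norm p M f)"

definition Lp_compact_operator ::
  "real \<Rightarrow> 'a measure \<Rightarrow> ('a \<Rightarrow> complex) set \<Rightarrow> (('a \<Rightarrow> complex) \<Rightarrow> ('a \<Rightarrow> complex)) \<Rightarrow> bool" where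
  "Lp_compact_operator p M X T \<longleftrightarrow> (\<forall>f\<in>X. T f \<in> Lp_space p M) \<and>
     (\<forall>F. (\<forall>k::nat. F k \<in> X) \<and> (\<exists>B. \<forall>k. Lp_norm p M (F k) \<le> B) \<longrightarrow>
        (\<exists>g\<in>Lp_space p M. \<exists>s. strict_mono s \<and>
           (\<lambda>k. Lp_norm p M (\<lambda>x. T (F (s k)) x - g x)) \<longlonglongrightarrow> 0))"

definition weighted_comp ::
  "(complex \<Rightarrow> complex) \<Rightarrow> (complex \<Rightarrow> complex) \<Rightarrow> (complex \<Rightarrow> complex) \<Rightarrow> complex \<Rightarrow> complex" where
  "weighted_comp \<psi> \<phi> f = (\<lambda>z. \<psi> z * f (\<phi> z))"

definition power_compact ::
  "real \<Rightarrow> (real \<Rightarrow> real) \<Rightarrow> (complex \<Rightarrow> complex) \<Rightarrow> (complex \<Rightarrow> complex) \<Rightarrow> bool" where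
  "power_compact p \<sigma> \<psi> \<phi> \<longleftrightarrow> (\<exists>n\<ge>1.
     Lp_compact_operator p (Omega \<sigma>) (bergman_space p \<sigma>) (weighted_comp \<psi> \<phi> ^^ n))"

definition iterated_weight ::
  "(complex \<Rightarrow> complex) \<Rightarrow> (complex \<Rightarrow> complex) \<Rightarrow> nat \<Rightarrow> complex \<Rightarrow> complex" where
  "iterated_weight \<psi> \<phi> n z = (\<Prod>j<n. \<psi> ((\<phi> ^^ j) z))"

definition Omega_n ::
  "real \<Rightarrow> (real \<Rightarrow> real) \<Rightarrow> (complex \<Rightarrow> complex) \<Rightarrow> (complex \<Rightarrow> complex) \<Rightarrow> nat \<Rightarrow> complex measure"
where
  "Omega_n p \<sigma> \<psi> \<phi> n =
     distr (density (Omega \<sigma>) (\<lambda>z. ennreal (cmod (iterated_weight \<psi> \<phi> n z) powr p)))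
       (Omega \<sigma>) (\<phi> ^^ n)"

definition pseudohyperbolic_disc :: "complex \<Rightarrow> real \<Rightarrow> complex set" where
  "pseudohyperbolic_disc a r = {z \<in> unit_disc. cmod ((a - z) / (1 - cnj a * z)) < r}"

definition lattice_seq :: "real \<Rightarrow> (nat \<Rightarrow> complex) \<Rightarrow> bool" where
  "lattice_seq r z \<longleftrightarrow> range z \<subseteq> unit_disc \<and>
     unit_disc \<subseteq> (\<Union>k. pseudohyperbolic_disc (z k) r) \<and>
     (\<exists>M>0. \<forall>w\<in>unit_disc.
        finite {k. w \<in> pseudohyperbolic_disc (z k) ((1 + r) / 2)} \<and>
        card {k. w \<in> pseudohyperbolic_disc (z k) ((1 + r) / 2)} \<le> M)"

text \<open>For \<open>z\<close> and \<open>w\<close> in the disc the base has positive real part, so the principal power is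
  analytic there; \<open>bergman_kernel \<alpha> z z\<close> is a positive real, so \<open>csqrt\<close> is its usual root.\<close>

definition bergman_kernel :: "real \<Rightarrow> complex \<Rightarrow> complex \<Rightarrow> complex" where
  "bergman_kernel \<alpha> z w = (1 - cnj w * z) powr (- complex_of_real (\<alpha> + 2))"

definition normalized_kernel :: "real \<Rightarrow> complex \<Rightarrow> complex \<Rightarrow> complex" where
  "normalized_kernel \<alpha> z w = bergman_kernel \<alpha> z w / csqrt (bergman_kernel \<alpha> z z)"

definition berezin :: "real \<Rightarrow> real \<Rightarrow> complex measure \<Rightarrow> complex \<Rightarrow> ennreal" where
  "berezin \<alpha> t \<mu> z = (\<integral>\<^sup>+w. ennreal (cmod (normalized_kernel \<alpha> z w) powr t) \<partial>\<mu>)"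

definition averaging :: "real \<Rightarrow> complex measure \<Rightarrow> complex \<Rightarrow> ennreal" where
  "averaging r \<mu> z =
     emeasure \<mu> (pseudohyperbolic_disc z r) / emeasure dA (pseudohyperbolic_disc z r)"

end

theory Submission
  imports Defs
begin

text \<open>A weight is continuous and positive on the \<^emph>\<open>closed\<close> interval \<open>[0,1]\<close>, so it is pinched
  between two positive constants. Hence \<open>A\<^sup>p\<^sub>\<sigma>\<close> is the classical Bergman space with an equivalent
  (quasi-)norm, \<open>\<sigma>\<close> may be dropped from all three quotients, and what remains is the description of
  the vanishing Carleson measures of that space. Write \<open>d z = 1 - cmod z\<close> for the boundary distance,
  \<open>E z R\<close> for the pseudohyperbolic disc, \<open>s = (\<alpha> + 2) t > 2\<close>, and let \<open>\<mu>\<close> be the pullback measure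
  \<open>\<Omega>\<^sub>n\<close>, for which \<open>\<integral> |f|\<^sup>p d\<mu>\<close> is the \<open>p\<close>-th power of the norm of \<open>C\<^sup>n f\<close>. Up to constant factors
  the Berezin quotient at \<open>a\<close> is the integral over \<open>\<mu>\<close> of
  \<open>d a powr (s - 2) / cmod (1 - cnj a * w) powr s\<close> (\<open>berezin_density\<close>), and the averaging quotient at
  \<open>z\<close> is \<open>\<mu> (E z R) / (d z)\<^sup>2\<close>.

  For each single \<open>n\<close> the conditions are equivalent, and the implications form a cycle.

  \<^item> Compactness gives the Berezin condition (\<open>berezin_vanishes_if_compact\<close>). The density above is
    exactly \<open>|f\<^sub>a|\<^sup>p\<close> for an explicit holomorphic \<open>f\<^sub>a\<close>. These functions are bounded in norm, which is
    where \<open>s > 2\<close> enters (\<open>berezin_density_integral_bound\<close>), and tend to \<open>0\<close> pointwise as \<open>a\<close>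
    approaches the circle, so a limit of \<open>C\<^sup>n f\<^sub>a\<close> along a subsequence in \<open>L\<^sup>p\<close> can only be \<open>0\<close>.

  \<^item> The Berezin condition gives vanishing averages for every \<open>R\<close> (\<open>vanishing_on_discs_if_berezin\<close>),
    because on \<open>E a R\<close> the density is comparable to \<open>1 / (d a)\<^sup>2\<close>.

  \<^item> Vanishing averages for one \<open>R\<close> give compactness (\<open>compact_if_vanishing_on_discs\<close>). By the
    submean value property of \<open>|f|\<^sup>p\<close> and Fubini, \<open>\<integral> |f|\<^sup>p d\<mu>\<close> over a collar of the circle is at most
    a small multiple of \<open>\<integral> |f|\<^sup>p dA\<close> (\<open>carleson_tail_bound\<close>). A bounded sequence has, by Montel,
    a locally uniformly convergent subsequence, which takes care of the rest of the disc.

  \<^item> The points of a lattice tend to the circle, so the averages vanish along it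
    (\<open>lattice_seq_to_unit_circle\<close>). Conversely, the lattice discs that meet \<open>E z R\<close> cover it, stay in
    a Euclidean ball of radius comparable to \<open>d z\<close>, and overlap boundedly, so that their total area
    is \<open>O((d z)\<^sup>2)\<close> and their smallness passes to \<open>E z R\<close> (\<open>lattice_vanishing_on_discs\<close>). Lattices
    exist for every \<open>r\<close>, as maximal separated sets (\<open>lattice_seq_exists\<close>), so a condition on all
    lattices does imply the condition on some lattice.\<close>

section \<open>Pseudohyperbolic discs\<close>

lemma norm_one_minus_ge:
  assumes "cmod a < 1" "cmod z < 1"
  shows "1 - cmod a \<le> cmod (1 - cnj a * z)"
proof -
  have "cmod (cnj a * z) \<le> cmod a * 1"
    unfolding norm_mult complex_mod_cnj using assms by (intro mult_left_mono) auto
  moreover have "1 - cmod (cnj a * z) \<le> cmod (1 - cnj a * z)"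
    using norm_triangle_ineq2[of 1 "cnj a * z"] by simp
  ultimately show ?thesis by linarith
qed

lemma norm_one_minus_cnj_commute: "cmod (1 - cnj a * z) = cmod (1 - cnj z * a)"
proof -
  have "cnj (1 - cnj a * z) = 1 - cnj z * a" by (simp add: mult.commute)
  then show ?thesis by (metis complex_mod_cnj)
qed

lemma mem_pseudohyperbolic_disc:
  assumes "cmod a < 1"
  shows "z \<in> pseudohyperbolic_disc a r \<longleftrightarrow> cmod z < 1 \<and> cmod (a - z) < r * cmod (1 - cnj a * z)"
proof (cases "cmod z < 1")
  case True
  then have "0 < cmod (1 - cnj a * z)"
    using norm_one_minus_ge[OF assms True] assms by linarith
  then show ?thesis
    using True by (simp add: pseudohyperbolic_disc_def norm_divide pos_divide_less_eq)
qed (simp add: pseudohyperbolic_disc_def)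

lemma pseudohyperbolic_disc_commute:
  assumes "cmod a < 1" "cmod z < 1"
  shows "z \<in> pseudohyperbolic_disc a r \<longleftrightarrow> a \<in> pseudohyperbolic_disc z r"
  using assms by (simp add: mem_pseudohyperbolic_disc norm_minus_commute norm_one_minus_cnj_commute)

text \<open>Write \<open>1 - cnj a * z = (1 - |a|\<^sup>2) + cnj a * (a - z)\<close>; on the disc the second term is at most
\<open>r\<close> times the left-hand side and can be absorbed. Together with \<open>norm_one_minus_ge\<close> this makes
\<open>|1 - cnj a * z|\<close>, \<open>1 - |a|\<close> and \<open>1 - |z|\<close> mutually comparable on the disc, with constants that
depend on \<open>r\<close> only. All later estimates rest on this.\<close>

lemma pseudohyperbolic_disc_kernel_bound:
  assumes "cmod a < 1" "0 < r" "r < 1" "z \<in> pseudohyperbolic_disc a r"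
  shows "cmod (1 - cnj a * z) \<le> 2 / (1 - r) * (1 - cmod a)"
proof -
  have z: "cmod z < 1" "cmod (a - z) < r * cmod (1 - cnj a * z)"
    using assms mem_pseudohyperbolic_disc by auto
  have "1 - cnj a * z = (1 - cnj a * a) + cnj a * (a - z)"
    by (simp add: algebra_simps)
  then have "cmod (1 - cnj a * z) \<le> cmod (1 - cnj a * a) + cmod (cnj a * (a - z))"
    by (metis norm_triangle_ineq)
  also have "cnj a * a = complex_of_real ((cmod a)\<^sup>2)"
    by (metis complex_norm_square mult.commute)
  also have "cmod (1 - complex_of_real ((cmod a)\<^sup>2)) = 1 - (cmod a)\<^sup>2"
    using assms(1) by (metis abs_of_nonneg diff_ge_0_iff_ge less_eq_real_def norm_ge_zero norm_of_real
        of_real_1 of_real_diff power_le_one)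
  also have "cmod (cnj a * (a - z)) \<le> 1 * cmod (a - z)"
    unfolding norm_mult complex_mod_cnj using assms by (intro mult_right_mono) auto
  also have "1 * cmod (a - z) \<le> r * cmod (1 - cnj a * z)" using z by simp
  finally have "(1 - r) * cmod (1 - cnj a * z) \<le> 1 - (cmod a)\<^sup>2"
    by (simp add: algebra_simps)
  also have "1 - (cmod a)\<^sup>2 = (1 + cmod a) * (1 - cmod a)"
    by (simp add: algebra_simps power2_eq_square)
  also have "\<dots> \<le> 2 * (1 - cmod a)" using assms by (intro mult_right_mono) auto
  finally show ?thesis using assms by (simp add: field_simps)
qed

text \<open>Both bounds are the previous lemma combined with \<open>norm_one_minus_ge\<close>, once with the centre at \<open>a\<close>
and once, by symmetry of the pseudohyperbolic distance, at \<open>z\<close>.\<close>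

lemma pseudohyperbolic_disc_boundary_dist:
  assumes "cmod a < 1" "0 < r" "r < 1" "z \<in> pseudohyperbolic_disc a r"
  shows "1 - cmod a \<le> 2 / (1 - r) * (1 - cmod z)" "1 - cmod z \<le> 2 / (1 - r) * (1 - cmod a)"
proof -
  have z: "cmod z < 1" using assms mem_pseudohyperbolic_disc by auto
  have "a \<in> pseudohyperbolic_disc z r" using assms z pseudohyperbolic_disc_commute by blast
  from pseudohyperbolic_disc_kernel_bound[OF z assms(2,3) this] norm_one_minus_ge[OF assms(1) z]
  show "1 - cmod a \<le> 2 / (1 - r) * (1 - cmod z)"
    by (simp add: norm_one_minus_cnj_commute[of a z])
  from pseudohyperbolic_disc_kernel_bound[OF assms] norm_one_minus_ge[OF z assms(1)]
  show "1 - cmod z \<le> 2 / (1 - r) * (1 - cmod a)"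
    by (simp add: norm_one_minus_cnj_commute[of a z])
qed

lemma pseudohyperbolic_disc_subset_ball:
  assumes "cmod a < 1" "0 < r" "r < 1"
  shows "pseudohyperbolic_disc a r \<subseteq> ball a (2 / (1 - r) * (1 - cmod a))"
proof
  fix z assume z: "z \<in> pseudohyperbolic_disc a r"
  have "cmod (a - z) < r * cmod (1 - cnj a * z)"
    using assms z mem_pseudohyperbolic_disc by auto
  also have "\<dots> \<le> 1 * cmod (1 - cnj a * z)" using assms by (intro mult_right_mono) auto
  also have "\<dots> \<le> 2 / (1 - r) * (1 - cmod a)"
    using pseudohyperbolic_disc_kernel_bound[OF assms z] by simp
  finally show "z \<in> ball a (2 / (1 - r) * (1 - cmod a))" by (simp add: dist_norm)
qed

lemma ball_subset_unit_disc:
  assumes "cmod a < 1" "0 < r" "r \<le> 1"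
  shows "ball a (r * (1 - cmod a)) \<subseteq> unit_disc"
proof
  fix z assume z: "z \<in> ball a (r * (1 - cmod a))"
  have "cmod z \<le> cmod a + cmod (a - z)" by (metis norm_minus_commute norm_triangle_sub)
  also have "cmod (a - z) < r * (1 - cmod a)" using z by (simp add: dist_norm)
  also have "r * (1 - cmod a) \<le> 1 * (1 - cmod a)" using assms by (intro mult_right_mono) auto
  finally show "z \<in> unit_disc" by simp
qed

lemma ball_subset_pseudohyperbolic_disc:
  assumes "cmod a < 1" "0 < r" "r < 1"
  shows "ball a (r * (1 - cmod a)) \<subseteq> pseudohyperbolic_disc a r"
proof
  fix z assume z: "z \<in> ball a (r * (1 - cmod a))"
  have z1: "cmod z < 1" using ball_subset_unit_disc[of a r] assms z by auto
  have "cmod (a - z) < r * (1 - cmod a)" using z by (simp add: dist_norm)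
  also have "\<dots> \<le> r * cmod (1 - cnj a * z)"
    using assms norm_one_minus_ge[OF assms(1) z1] by (intro mult_left_mono) auto
  finally show "z \<in> pseudohyperbolic_disc a r"
    using z1 assms mem_pseudohyperbolic_disc by auto
qed

lemma open_pseudohyperbolic_disc:
  assumes "cmod a < 1"
  shows "open (pseudohyperbolic_disc a r)"
proof -
  have "pseudohyperbolic_disc a r = unit_disc \<inter> {z. cmod (a - z) < r * cmod (1 - cnj a * z)}"
    using mem_pseudohyperbolic_disc[OF assms] by auto
  moreover have "open {z. cmod (a - z) < r * cmod (1 - cnj a * z)}"
    by (intro open_Collect_less continuous_intros)
  ultimately show ?thesis by (simp add: open_Int)
qed

section \<open>Normalized area measure\<close>

lemma space_dA [simp]: "space dA = unit_disc"
  by (simp add: dA_def space_restrict_space)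

lemma sets_dA: "sets dA = sets (restrict_space borel unit_disc)"
  by (simp add: dA_def sets_restrict_space)

lemma sets_dA_iff: "A \<in> sets dA \<longleftrightarrow> A \<in> sets borel \<and> A \<subseteq> unit_disc"
  unfolding sets_dA by (subst sets_restrict_space_iff) auto

lemma measurable_dA_continuous:
  fixes f :: "complex \<Rightarrow> 'b::topological_space"
  assumes "continuous_on unit_disc f"
  shows "f \<in> borel_measurable dA"
  using borel_measurable_continuous_on_restrict[OF assms] sets_dA
  by (metis measurable_cong_sets sets_dA)

lemma emeasure_dA:
  assumes "A \<in> sets borel" "A \<subseteq> unit_disc"
  shows "emeasure dA A = ennreal (1 / pi) * emeasure lborel A"
proof -
  have m: "A \<in> sets (restrict_space lborel unit_disc)"
    using assms sets_restrict_space_iff[of unit_disc lborel A] by auto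
  then have "emeasure dA A = \<integral>\<^sup>+ x. ennreal (1 / pi) * indicator A x \<partial>restrict_space lborel unit_disc"
    by (simp add: dA_def emeasure_density)
  also have "\<dots> = ennreal (1 / pi) * emeasure (restrict_space lborel unit_disc) A"
    using m by (rule nn_integral_cmult_indicator)
  also have "emeasure (restrict_space lborel unit_disc) A = emeasure lborel A"
    using assms by (intro emeasure_restrict_space) auto
  finally show ?thesis .
qed

lemma emeasure_lborel_ball_complex:
  "0 \<le> r \<Longrightarrow> emeasure lborel (ball (c::complex) r) = ennreal (pi * r\<^sup>2)"
  by (simp add: emeasure_ball unit_ball_vol_2 ennreal_mult'')

lemma emeasure_dA_ball:
  assumes "ball c r \<subseteq> unit_disc" "0 \<le> r"
  shows "emeasure dA (ball c r) = ennreal (r\<^sup>2)"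
  using assms by (simp add: emeasure_dA emeasure_lborel_ball_complex flip: ennreal_mult)

lemma emeasure_dA_le_ball:
  assumes "A \<in> sets borel" "A \<subseteq> unit_disc" "A \<subseteq> ball c r" "0 \<le> r"
  shows "emeasure dA A \<le> ennreal (r\<^sup>2)"
proof -
  have "emeasure dA A = ennreal (1 / pi) * emeasure lborel A" using assms by (simp add: emeasure_dA)
  also have "\<dots> \<le> ennreal (1 / pi) * emeasure lborel (ball c r)"
    using assms by (intro mult_left_mono emeasure_mono) auto
  also have "\<dots> = ennreal (r\<^sup>2)"
    using assms by (simp add: emeasure_lborel_ball_complex flip: ennreal_mult)
  finally show ?thesis .
qed

lemma finite_measure_dA: "finite_measure dA"
proof
  show "emeasure dA (space dA) \<noteq> \<infinity>"
    using emeasure_dA_ball[of 0 1] by simp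
qed

lemma pseudohyperbolic_disc_subset: "pseudohyperbolic_disc a r \<subseteq> unit_disc"
  by (auto simp: pseudohyperbolic_disc_def)

lemma pseudohyperbolic_disc_in_sets: "cmod a < 1 \<Longrightarrow> pseudohyperbolic_disc a r \<in> sets dA"
  using open_pseudohyperbolic_disc[of a r] pseudohyperbolic_disc_subset by (auto simp: sets_dA_iff)

lemma emeasure_dA_pseudohyperbolic_disc_le:
  assumes "cmod a < 1" "0 < r" "r < 1"
  shows "emeasure dA (pseudohyperbolic_disc a r) \<le> ennreal ((2 / (1 - r) * (1 - cmod a))\<^sup>2)"
  using assms open_pseudohyperbolic_disc[of a r] pseudohyperbolic_disc_subset
    pseudohyperbolic_disc_subset_ball[OF assms]
  by (intro emeasure_dA_le_ball) auto

lemma emeasure_dA_pseudohyperbolic_disc_ge: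
  assumes "cmod a < 1" "0 < r" "r < 1"
  shows "ennreal ((r * (1 - cmod a))\<^sup>2) \<le> emeasure dA (pseudohyperbolic_disc a r)"
proof -
  have "ennreal ((r * (1 - cmod a))\<^sup>2) = emeasure dA (ball a (r * (1 - cmod a)))"
    using assms ball_subset_unit_disc[of a r] by (subst emeasure_dA_ball) auto
  also have "\<dots> \<le> emeasure dA (pseudohyperbolic_disc a r)"
    using assms ball_subset_pseudohyperbolic_disc pseudohyperbolic_disc_in_sets
    by (intro emeasure_mono) auto
  finally show ?thesis .
qed

section \<open>The submean value property of \<open>|f|\<^sup>p\<close>\<close>

text \<open>This replaces subharmonicity of \<open>|f|\<^sup>p\<close> by an argument that treats all \<open>p > 0\<close> alike. The point
\<open>z0\<close> maximises \<open>(r/2 - |z - w|) powr (2/p) * |f z|\<close>. Maximality bounds \<open>|f|\<close> near \<open>z0\<close> by a constant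
multiple of \<open>|f z0|\<close>, so by the Cauchy estimate \<open>f\<close> stays close to \<open>f z0\<close> on a ball whose radius is
a fixed fraction of \<open>r/2 - |z0 - w|\<close>. Comparing the maximum with the value at
\<open>w\<close> shows that this ball is large enough, in the precise sense of the last conclusion.\<close>

lemma holomorphic_large_on_disc:
  assumes holf: "f holomorphic_on ball w r" and "0 < r" "0 < p"
  obtains z0 \<delta> where "0 < \<delta>" "ball z0 \<delta> \<subseteq> ball w r"
    "\<And>z. z \<in> ball z0 \<delta> \<Longrightarrow> cmod (f z0) / 2 \<le> cmod (f z)"
    "cmod (f w) powr p * r\<^sup>2 \<le> 256 * 2 powr (4 / p) * cmod (f z0) powr p * \<delta>\<^sup>2"
proof (cases "f w = 0")
  case True
  show ?thesis by (rule that[of r w]) (use True assms in auto)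
next
  case False
  define \<rho> where "\<rho> = r / 2"
  define K where "K = (2::real) powr (2 / p)"
  define g where "g z = (\<rho> - cmod (z - w)) powr (2 / p) * cmod (f z)" for z
  have \<rho>: "0 < \<rho>" using assms by (simp add: \<rho>_def)
  have K1: "1 \<le> K" using assms by (simp add: K_def ge_one_powr_ge_zero)
  have sub: "cball w \<rho> \<subseteq> ball w r" using assms by (auto simp: \<rho>_def)
  have contf: "continuous_on (ball w r) f" using holf holomorphic_on_imp_continuous_on by blast
  have "continuous_on (cball w \<rho>) g"
    unfolding g_def using assms
    by (intro continuous_intros continuous_on_powr' continuous_on_subset[OF contf sub])
       (auto simp: dist_norm norm_minus_commute)
  moreover have "cball w \<rho> \<noteq> {}" using \<rho> by auto
  ultimately obtain z0 where z0: "z0 \<in> cball w \<rho>" and mx: "\<And>z. z \<in> cball w \<rho> \<Longrightarrow> g z \<le> g z0"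
    using continuous_attains_sup[of "cball w \<rho>" g] by auto
  have "0 < \<rho> powr (2 / p) * cmod (f w)" using False \<rho> by simp
  also have "\<dots> = g w" by (simp add: g_def)
  also have gw: "\<dots> \<le> g z0" using mx \<rho> by simp
  finally have g0: "0 < g z0" .
  then have fz0: "0 < cmod (f z0)" by (auto simp: g_def zero_less_mult_iff)
  \<comment> \<open>The maximum is positive, so \<open>z0\<close> is interior and \<open>d > 0\<close>. On \<open>cball z0 d\<close> the distance
    \<open>\<rho> - |z - w|\<close> to the sphere is still at least half of its value \<open>2 d\<close> at \<open>z0\<close>.\<close>
  define d where "d = (\<rho> - cmod (z0 - w)) / 2"
  have d: "0 < d"
    using g0 z0 unfolding g_def d_def
    by (cases "cmod (z0 - w) = \<rho>") (auto simp: dist_norm norm_minus_commute)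
  have d2: "\<rho> - cmod (z0 - w) = 2 * d" by (simp add: d_def)
  have cb: "cball z0 d \<subseteq> cball w \<rho>"
  proof
    fix z assume "z \<in> cball z0 d"
    then have "cmod (z0 - z) \<le> d" by (simp add: dist_norm)
    moreover have "cmod (w - z) \<le> cmod (z0 - w) + cmod (z0 - z)"
      using dist_triangle[of w z z0] by (simp add: dist_norm norm_minus_commute)
    ultimately show "z \<in> cball w \<rho>" using d by (simp add: d_def dist_norm)
  qed
  have bnd: "cmod (f z) \<le> K * cmod (f z0)" if "z \<in> cball z0 d" for z
  proof -
    have "cmod (z0 - z) \<le> d" using that by (simp add: dist_norm)
    moreover have "cmod (z - w) \<le> cmod (z0 - w) + cmod (z0 - z)"
      using dist_triangle[of w z z0] by (simp add: dist_norm norm_minus_commute)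
    ultimately have "d \<le> \<rho> - cmod (z - w)" by (simp add: d_def field_simps)
    then have "d powr (2/p) * cmod (f z) \<le> g z"
      unfolding g_def using d assms by (intro mult_right_mono powr_mono2) auto
    also have "\<dots> \<le> g z0" using that cb by (intro mx) auto
    also have "g z0 = (2 * d) powr (2/p) * cmod (f z0)" unfolding g_def by (simp only: d2)
    also have "\<dots> = d powr (2/p) * (K * cmod (f z0))" using d by (simp add: powr_mult K_def)
    finally show ?thesis using d by simp
  qed
  have der: "cmod (deriv f z) \<le> K * cmod (f z0) / (d / 2)" if "z \<in> ball z0 (d / 2)" for z
  proof -
    have s: "cball z (d / 2) \<subseteq> cball z0 d"
    proof
      fix x assume "x \<in> cball z (d / 2)"
      then show "x \<in> cball z0 d" using that dist_triangle[of z0 x z] by auto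
    qed
    have s2: "cball z (d / 2) \<subseteq> ball w r" using s cb sub by blast
    have "norm ((deriv ^^ 1) f z) \<le> fact 1 * (K * cmod (f z0)) / (d / 2) ^ 1"
    proof (rule Cauchy_inequality)
      show "f holomorphic_on ball z (d / 2)"
        using holf s2 ball_subset_cball holomorphic_on_subset by blast
      show "continuous_on (cball z (d / 2)) f" using contf s2 continuous_on_subset by blast
      show "0 < d / 2" using d by simp
      fix x assume "cmod (z - x) = d / 2"
      then have "x \<in> cball z0 d" using s by (auto simp: dist_norm)
      then show "cmod (f x) \<le> K * cmod (f z0)" by (rule bnd)
    qed
    then show ?thesis by simp
  qed
  \<comment> \<open>With \<open>|f'| \<le> 2 K |f z0| / d\<close>, this radius lets \<open>f\<close> vary by at most \<open>|f z0| / 2\<close>.\<close>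
  define \<delta> where "\<delta> = d / (4 * K)"
  have \<delta>: "0 < \<delta>" "\<delta> \<le> d / 2" using d K1 by (auto simp: \<delta>_def field_simps)
  show ?thesis
  proof (rule that[of \<delta> z0])
    have "ball z0 \<delta> \<subseteq> cball z0 d" using \<delta> by auto
    then show "ball z0 \<delta> \<subseteq> ball w r" using cb sub by blast
    show "0 < \<delta>" by fact
  next
    fix z assume z: "z \<in> ball z0 \<delta>"
    have "cmod (f z - f z0) \<le> (K * cmod (f z0) / (d / 2)) * cmod (z - z0)"
    proof (rule field_differentiable_bound[of "ball z0 (d/2)" f "deriv f"])
      fix x assume x: "x \<in> ball z0 (d / 2)"
      then have "x \<in> cball z0 d" using d by (auto simp: dist_norm)
      then have "x \<in> ball w r" using cb sub by blast
      then show "(f has_field_derivative deriv f x) (at x within ball z0 (d / 2))"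
        using holf holomorphic_derivI[OF holf] by (simp add: has_field_derivative_at_within)
      show "cmod (deriv f x) \<le> K * cmod (f z0) / (d / 2)" using der x by blast
    qed (use z \<delta> d in auto)
    also have "\<dots> \<le> (K * cmod (f z0) / (d / 2)) * \<delta>"
      using z K1 d by (intro mult_left_mono) (auto simp: dist_norm norm_minus_commute)
    also have "\<dots> = cmod (f z0) / 2" using d K1 by (simp add: \<delta>_def)
    finally show "cmod (f z0) / 2 \<le> cmod (f z)"
      using norm_triangle_ineq2[of "f z0" "f z"] by (simp add: norm_minus_commute)
  next
    have "\<rho> powr (2 / p) * cmod (f w) \<le> (2 * d) powr (2 / p) * cmod (f z0)"
      using gw by (simp add: g_def flip: d2)
    then have "(\<rho> powr (2 / p) * cmod (f w)) powr p \<le> ((2 * d) powr (2 / p) * cmod (f z0)) powr p"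
      using assms by (intro powr_mono2) auto
    then have "\<rho>\<^sup>2 * cmod (f w) powr p \<le> (2 * d)\<^sup>2 * cmod (f z0) powr p"
      using assms d \<rho> by (simp add: powr_mult powr_powr)
    moreover have "d = 4 * K * \<delta>" using K1 by (simp add: \<delta>_def)
    moreover have "2 powr (4 / p) = K\<^sup>2"
      by (simp add: K_def power2_eq_square flip: powr_add)
    ultimately show "cmod (f w) powr p * r\<^sup>2 \<le> 256 * 2 powr (4 / p) * cmod (f z0) powr p * \<delta>\<^sup>2"
      by (simp only: \<rho>_def) (simp add: power2_eq_square algebra_simps)
  qed
qed

text \<open>The integral over the ball around \<open>z0\<close> found in \<open>holomorphic_large_on_disc\<close> suffices.\<close>

lemma holomorphic_powr_submean:
  fixes f :: "complex \<Rightarrow> complex"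
  assumes holf: "f holomorphic_on unit_disc" and sub: "ball w r \<subseteq> unit_disc" and "0 < r" "0 < p"
  shows "ennreal (cmod (f w) powr p * r\<^sup>2)
    \<le> ennreal (256 * 2 powr (4 / p) * 2 powr p) *
        (\<integral>\<^sup>+z. ennreal (cmod (f z) powr p) * indicator (ball w r) z \<partial>dA)"
proof -
  have "f holomorphic_on ball w r" using holf sub holomorphic_on_subset by blast
  from holomorphic_large_on_disc[OF this assms(3,4)] obtain z0 \<delta> where
    z0: "0 < \<delta>" "ball z0 \<delta> \<subseteq> ball w r"
    and lower: "\<And>z. z \<in> ball z0 \<delta> \<Longrightarrow> cmod (f z0) / 2 \<le> cmod (f z)"
    and main: "cmod (f w) powr p * r\<^sup>2 \<le> 256 * 2 powr (4 / p) * cmod (f z0) powr p * \<delta>\<^sup>2"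
    by metis
  let ?C = "256 * 2 powr (4 / p) * 2 powr p :: real"
  have "ball z0 \<delta> \<in> sets dA" using z0 sub by (auto simp: sets_dA_iff)
  then have "ennreal ((cmod (f z0) / 2) powr p * \<delta>\<^sup>2)
      = (\<integral>\<^sup>+z. ennreal ((cmod (f z0) / 2) powr p) * indicator (ball z0 \<delta>) z \<partial>dA)"
    using z0 sub emeasure_dA_ball[of z0 \<delta>] by (simp add: nn_integral_cmult_indicator ennreal_mult)
  also have "\<dots> \<le> (\<integral>\<^sup>+z. ennreal (cmod (f z) powr p) * indicator (ball w r) z \<partial>dA)"
  proof (rule nn_integral_mono)
    fix z
    show "ennreal ((cmod (f z0) / 2) powr p) * indicator (ball z0 \<delta>) z
      \<le> ennreal (cmod (f z) powr p) * indicator (ball w r) z"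
    proof (cases "z \<in> ball z0 \<delta>")
      case True
      then have "(cmod (f z0) / 2) powr p \<le> cmod (f z) powr p"
        using lower assms by (intro powr_mono2) auto
      then show ?thesis using True z0 by (auto simp: ennreal_leI)
    qed simp
  qed
  finally have *: "ennreal ((cmod (f z0) / 2) powr p * \<delta>\<^sup>2)
      \<le> (\<integral>\<^sup>+z. ennreal (cmod (f z) powr p) * indicator (ball w r) z \<partial>dA)" .
  have "cmod (f w) powr p * r\<^sup>2 \<le> ?C * ((cmod (f z0) / 2) powr p * \<delta>\<^sup>2)"
    using main by (simp add: powr_divide)
  then have "ennreal (cmod (f w) powr p * r\<^sup>2) \<le> ennreal ?C * ennreal ((cmod (f z0) / 2) powr p * \<delta>\<^sup>2)"
    by (subst ennreal_mult[symmetric]) (auto intro: ennreal_leI)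
  also have "\<dots> \<le> ennreal ?C * (\<integral>\<^sup>+z. ennreal (cmod (f z) powr p) * indicator (ball w r) z \<partial>dA)"
    using * by (rule mult_left_mono) simp
  finally show ?thesis .
qed

section \<open>The Berezin density\<close>

text \<open>Up to a factor between two positive constants, this is \<open>|k\<^sub>a(z)|\<^sup>t\<close> divided by
\<open>(1 - |a|\<^sup>2) powr (2 - s / 2)\<close> for \<open>s = (\<alpha> + 2) t\<close>; see \<open>norm_normalized_kernel_powr\<close>.\<close>

definition berezin_density :: "real \<Rightarrow> complex \<Rightarrow> complex \<Rightarrow> real" where
  "berezin_density s a z = (1 - cmod a) powr (s - 2) / cmod (1 - cnj a * z) powr s"

lemma berezin_density_nonneg [simp]: "0 \<le> berezin_density s a z"
  by (simp add: berezin_density_def)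

lemma one_minus_cnj_mult_nonzero:
  assumes "cmod a < 1" "cmod z < 1"
  shows "1 - cnj a * z \<noteq> 0"
  using norm_one_minus_ge[OF assms] assms by auto

lemma berezin_density_measurable:
  assumes "cmod a < 1"
  shows "berezin_density s a \<in> borel_measurable dA"
  unfolding berezin_density_def using assms
  by (intro measurable_dA_continuous continuous_intros) (auto dest: one_minus_cnj_mult_nonzero)

lemma term_le_suminf_ennreal: "f j \<le> (\<Sum>i. f i)" for f :: "nat \<Rightarrow> ennreal"
  using sum_le_suminf[of f "{j}"] by (simp add: summableI)

lemma real_dyadic_scale:
  fixes d x :: real
  assumes "0 < d" "d \<le> x"
  obtains j :: nat where "2 ^ j * d \<le> x" "x < 2 ^ Suc j * d"
proof -
  obtain n0 where "x / d < 2 ^ n0" using real_arch_pow[of 2 "x / d"] by auto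
  then have ex: "\<exists>n. x < 2 ^ n * d" using assms by (auto simp: field_simps)
  define n where "n = (LEAST n. x < 2 ^ n * d)"
  have n: "x < 2 ^ n * d" unfolding n_def using ex by (rule LeastI_ex)
  with assms have "n \<noteq> 0" by (cases n) auto
  then obtain j where j: "n = Suc j" by (cases n) auto
  have "\<not> x < 2 ^ j * d" using not_less_Least[of j "\<lambda>n. x < 2 ^ n * d"] j n_def by auto
  then show ?thesis using that[of j] n j by auto
qed

text \<open>A dyadic form of the Forelli-Rudin estimate. The region \<open>|1 - cnj a * z| < 2 ^ (j+1) * d\<close> lies in a
ball of radius \<open>2 ^ (j+2) * d\<close> around \<open>1 / cnj a\<close>, where \<open>d = 1 - |a|\<close>, hence has area
\<open>O(4 ^ j * d\<^sup>2)\<close>; on the \<open>j\<close>-th shell the density is at most \<open>2 powr (- j s) / d\<^sup>2\<close>. The resulting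
series is geometric with ratio \<open>2 powr (2 - s)\<close>, which is less than \<open>1\<close> exactly when \<open>s > 2\<close>.\<close>

lemma berezin_density_integral_bound:
  assumes s: "2 < s" and a: "1 / 2 \<le> cmod a" "cmod a < 1"
  shows "(\<integral>\<^sup>+z. ennreal (berezin_density s a z) \<partial>dA) \<le> ennreal (16 / (1 - 2 powr (2 - s)))"
proof -
  define d where "d = 1 - cmod a"
  have d: "0 < d" using a by (simp add: d_def)
  define A where "A j = {z \<in> unit_disc. cmod (1 - cnj a * z) < 2 ^ Suc j * d}" for j :: nat
  \<comment> \<open>The value of the density where \<open>|1 - cnj a * z|\<close> equals \<open>2 ^ j * d\<close>, an upper bound on the \<open>j\<close>-th shell.\<close>
  define c where "c j = d powr (s - 2) * (2 ^ j * d) powr (- s)" for j :: nat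
  have c0: "0 \<le> c j" for j by (simp add: c_def)
  have "open (unit_disc \<inter> {z. cmod (1 - cnj a * z) < 2 ^ Suc j * d})" for j :: nat
    by (intro open_Int open_Collect_less continuous_intros) auto
  then have opA: "open (A j)" for j by (simp add: A_def Int_def)
  have Asets: "A j \<in> sets dA" for j using opA[of j] by (auto simp: sets_dA_iff A_def)
  have A_measure: "emeasure dA (A j) \<le> ennreal ((2 ^ Suc (Suc j) * d)\<^sup>2)" for j
  proof (rule emeasure_dA_le_ball)
    show "A j \<subseteq> ball (1 / cnj a) (2 ^ Suc (Suc j) * d)"
    proof
      fix z assume z: "z \<in> A j"
      have a0: "a \<noteq> 0" using a by auto
      then have "1 - cnj a * z = cnj a * (1 / cnj a - z)" by (simp add: algebra_simps)
      then have "cmod a * cmod (1 / cnj a - z) = cmod (1 - cnj a * z)"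
        by (simp add: norm_mult)
      then have "cmod a * cmod (1 / cnj a - z) < 2 ^ Suc j * d" using z by (simp add: A_def)
      moreover have "1 / 2 * cmod (1 / cnj a - z) \<le> cmod a * cmod (1 / cnj a - z)"
        using a by (intro mult_right_mono) auto
      ultimately show "z \<in> ball (1 / cnj a) (2 ^ Suc (Suc j) * d)" by (simp add: dist_norm)
    qed
  qed (use d opA[of j] in \<open>auto simp: A_def\<close>)
  have "ennreal (berezin_density s a z) \<le> (\<Sum>j. ennreal (c j) * indicator (A j) z)"
    if "z \<in> space dA" for z
  proof -
    have z: "cmod z < 1" using that by simp
    obtain j where j: "2 ^ j * d \<le> cmod (1 - cnj a * z)" "cmod (1 - cnj a * z) < 2 ^ Suc j * d"
      using real_dyadic_scale[OF d] norm_one_minus_ge[OF a(2) z] d_def by metis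
    have "cmod (1 - cnj a * z) powr (- s) \<le> (2 ^ j * d) powr (- s)"
      using s d j by (intro powr_mono2') auto
    then have "berezin_density s a z \<le> c j"
      unfolding berezin_density_def c_def d_def[symmetric]
      by (simp add: powr_minus divide_inverse mult_left_mono)
    then have "ennreal (berezin_density s a z) \<le> ennreal (c j) * indicator (A j) z"
      using j z by (simp add: A_def ennreal_leI)
    also have "\<dots> \<le> (\<Sum>j. ennreal (c j) * indicator (A j) z)"
      by (rule term_le_suminf_ennreal)
    finally show ?thesis .
  qed
  then have "(\<integral>\<^sup>+z. ennreal (berezin_density s a z) \<partial>dA)
      \<le> (\<integral>\<^sup>+z. (\<Sum>j. ennreal (c j) * indicator (A j) z) \<partial>dA)"
    by (rule nn_integral_mono)
  also have "\<dots> = (\<Sum>j. \<integral>\<^sup>+z. ennreal (c j) * indicator (A j) z \<partial>dA)"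
    using Asets by (intro nn_integral_suminf) auto
  also have "\<dots> = (\<Sum>j. ennreal (c j) * emeasure dA (A j))"
    using Asets by (simp add: nn_integral_cmult_indicator)
  also have "\<dots> \<le> (\<Sum>j. ennreal (16 * (2 powr (2 - s)) ^ j))"
  proof (intro suminf_le summableI)
    fix j
    have "c j * (2 ^ Suc (Suc j) * d)\<^sup>2 = 16 * (2 powr (2 - s)) ^ j"
    proof -
      have "d powr (s - 2) * d powr (- s) * d powr 2 = 1"
        unfolding powr_add[symmetric] using d by simp
      then have 1: "d powr (s - 2) * d powr (- s) * d\<^sup>2 = 1"
        using d by (simp only: powr_numeral)
      have 2: "(2 ^ j) powr (- s) * (2 ^ j)\<^sup>2 = (2 powr (2 - s)) ^ j"
      proof -
        have "(2 ^ j :: real) = 2 powr real j" by (simp add: powr_realpow)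
        moreover have "(2 ^ j :: real)\<^sup>2 = 2 powr (2 * real j)"
          by (simp add: powr_powr powr_realpow[symmetric] mult.commute flip: powr_numeral)
        moreover have "(2 powr (2 - s)) ^ j = 2 powr ((2 - s) * real j)"
          by (simp add: powr_powr flip: powr_realpow)
        ultimately show ?thesis
          by (simp add: powr_powr algebra_simps flip: powr_add)
      qed
      have "c j * (2 ^ Suc (Suc j) * d)\<^sup>2
          = 16 * ((2 ^ j) powr (- s) * (2 ^ j)\<^sup>2) * (d powr (s - 2) * d powr (- s) * d\<^sup>2)"
        using d unfolding c_def by (simp add: powr_mult power_mult_distrib)
      then show ?thesis by (simp only: 1 2)
    qed
    moreover have "ennreal (c j) * emeasure dA (A j) \<le> ennreal (c j) * ennreal ((2 ^ Suc (Suc j) * d)\<^sup>2)"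
      using A_measure by (rule mult_left_mono) simp
    ultimately show "ennreal (c j) * emeasure dA (A j) \<le> ennreal (16 * (2 powr (2 - s)) ^ j)"
      using c0 by (simp flip: ennreal_mult)
  qed
  also have "\<dots> = ennreal (16 / (1 - 2 powr (2 - s)))"
  proof (rule suminf_ennreal_eq)
    have "2 powr (2 - s) < (2::real) powr 0" using s by (intro powr_less_mono) auto
    then have "(\<lambda>j. (2 powr (2 - s)) ^ j) sums (1 / (1 - 2 powr (2 - s)))"
      by (intro geometric_sums) simp
    then show "(\<lambda>j. 16 * (2 powr (2 - s)) ^ j) sums (16 / (1 - 2 powr (2 - s)))"
      using sums_mult[of _ _ 16] by fastforce
  qed simp
  finally show ?thesis .
qed

text \<open>By \<open>pseudohyperbolic_disc_kernel_bound\<close>, the density at \<open>a\<close> is bounded below by a multiple of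
\<open>1 / (1 - |a|)\<^sup>2\<close> throughout the disc around \<open>a\<close>.\<close>

lemma emeasure_pseudohyperbolic_disc_le_berezin:
  assumes mu: "sets \<mu> = sets dA" and a: "cmod a < 1" and R: "0 < R" "R < 1" and s: "0 < s"
  shows "emeasure \<mu> (pseudohyperbolic_disc a R)
    \<le> ennreal ((2 / (1 - R)) powr s * (1 - cmod a)\<^sup>2) * (\<integral>\<^sup>+w. ennreal (berezin_density s a w) \<partial>\<mu>)"
proof -
  let ?E = "pseudohyperbolic_disc a R" and ?c = "(2 / (1 - R)) powr s * (1 - cmod a)\<^sup>2"
  have E: "?E \<in> sets \<mu>" using mu a pseudohyperbolic_disc_in_sets by simp
  have meas: "berezin_density s a \<in> borel_measurable \<mu>"
    using berezin_density_measurable[OF a] mu measurable_cong_sets by blast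
  have "emeasure \<mu> ?E = (\<integral>\<^sup>+w. indicator ?E w \<partial>\<mu>)" using E by simp
  also have "\<dots> \<le> (\<integral>\<^sup>+w. ennreal ?c * ennreal (berezin_density s a w) \<partial>\<mu>)"
  proof (intro nn_integral_mono)
    fix w
    show "indicator ?E w \<le> ennreal ?c * ennreal (berezin_density s a w)"
    proof (cases "w \<in> ?E")
      case True
      then have w1: "cmod w < 1" using mem_pseudohyperbolic_disc[OF a] by auto
      have pos: "0 < cmod (1 - cnj a * w)" using one_minus_cnj_mult_nonzero[OF a w1] by simp
      have "cmod (1 - cnj a * w) \<le> 2 / (1 - R) * (1 - cmod a)"
        using pseudohyperbolic_disc_kernel_bound[OF a R True] .
      then have "cmod (1 - cnj a * w) powr s \<le> (2 / (1 - R) * (1 - cmod a)) powr s"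
        using s by (intro powr_mono2) auto
      also have "\<dots> = (2 / (1 - R)) powr s * (1 - cmod a) powr s" by (rule powr_mult)
      also have "(1 - cmod a) powr s = (1 - cmod a) powr 2 * (1 - cmod a) powr (s - 2)"
        by (simp only: powr_add[symmetric]) simp
      also have "(1 - cmod a) powr 2 = (1 - cmod a)\<^sup>2" using a by (simp add: powr_numeral)
      finally have "1 \<le> ?c * berezin_density s a w"
        using pos unfolding berezin_density_def by (simp add: field_simps)
      then show ?thesis
        using True by (simp flip: ennreal_mult ennreal_1 add: ennreal_leI)
    qed simp
  qed
  also have "\<dots> = ennreal ?c * (\<integral>\<^sup>+w. ennreal (berezin_density s a w) \<partial>\<mu>)"
    using meas by (intro nn_integral_cmult) auto
  finally show ?thesis .
qed

section \<open>Vanishing Carleson measures\<close>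

text \<open>The normalization by the square of the boundary distance in place of the area of the disc avoids
quotients in \<open>ennreal\<close>; both normalizations agree up to constants.\<close>

definition vanishing_on_discs :: "complex measure \<Rightarrow> real \<Rightarrow> bool" where
  "vanishing_on_discs \<mu> R \<longleftrightarrow> (\<forall>\<epsilon>>0. \<exists>\<rho><1. \<forall>z. \<rho> < cmod z \<and> cmod z < 1 \<longrightarrow>
     emeasure \<mu> (pseudohyperbolic_disc z R) \<le> ennreal (\<epsilon> * (1 - cmod z)\<^sup>2))"

definition submean_const :: "real \<Rightarrow> real" where
  "submean_const p = 256 * 2 powr (4 / p) * 2 powr p"

lemma submean_const_pos: "0 < submean_const p"
  by (simp add: submean_const_def)

definition carleson_const :: "real \<Rightarrow> real \<Rightarrow> real" where
  "carleson_const p R = submean_const p / R\<^sup>2 * (2 / (1 - R))\<^sup>2"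

lemma carleson_const_pos: "0 < R \<Longrightarrow> R < 1 \<Longrightarrow> 0 < carleson_const p R"
  by (simp add: carleson_const_def submean_const_pos)

lemma holomorphic_powr_measurable:
  assumes "f holomorphic_on unit_disc"
  shows "(\<lambda>z. cmod (f z) powr p) \<in> borel_measurable dA"
proof -
  have "f \<in> borel_measurable dA"
    using assms holomorphic_on_imp_continuous_on measurable_dA_continuous by blast
  then show ?thesis by measurable
qed

text \<open>The submean value inequality on the Euclidean ball of radius \<open>R (1 - |w|)\<close> inside the
pseudohyperbolic disc. The factor \<open>1 / (1 - |w|)\<^sup>2\<close> is moved under the integral and traded for
\<open>1 / (1 - |z|)\<^sup>2\<close>, so that after an application of Fubini it no longer depends on \<open>w\<close>.\<close>

lemma holomorphic_powr_le_disc_integral: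
  assumes holf: "f holomorphic_on unit_disc" and p: "0 < p" and R: "0 < R" "R < 1" and w: "cmod w < 1"
  shows "ennreal (cmod (f w) powr p)
    \<le> (\<integral>\<^sup>+z. ennreal (carleson_const p R * cmod (f z) powr p / (1 - cmod z)\<^sup>2) *
          indicator (pseudohyperbolic_disc w R) z \<partial>dA)"
proof -
  define d where "d = 1 - cmod w"
  have d: "0 < d" using w by (simp add: d_def)
  let ?B = "ball w (R * d)" and ?C = "submean_const p / (R * d)\<^sup>2"
  have C0: "0 \<le> ?C" using submean_const_pos[of p] by simp
  have meas: "(\<lambda>z. ennreal (cmod (f z) powr p) * indicator ?B z) \<in> borel_measurable dA"
  proof -
    have "?B \<in> sets dA" using ball_subset_unit_disc[OF w, of R] R d_def by (auto simp: sets_dA_iff)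
    then show ?thesis using holomorphic_powr_measurable[OF holf, of p] by measurable
  qed
  have "ennreal (cmod (f w) powr p) = ennreal (1 / (R * d)\<^sup>2) * ennreal (cmod (f w) powr p * (R * d)\<^sup>2)"
    using d R by (simp flip: ennreal_mult)
  also have "\<dots> \<le> ennreal (1 / (R * d)\<^sup>2) * (ennreal (submean_const p) *
        (\<integral>\<^sup>+z. ennreal (cmod (f z) powr p) * indicator ?B z \<partial>dA))"
    unfolding submean_const_def using ball_subset_unit_disc[OF w, of R] R d d_def
    by (intro mult_left_mono holomorphic_powr_submean[OF holf _ _ p]) auto
  also have "\<dots> = ennreal ?C * (\<integral>\<^sup>+z. ennreal (cmod (f z) powr p) * indicator ?B z \<partial>dA)"
    using submean_const_pos[of p] by (simp flip: mult.assoc ennreal_mult)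
  also have "\<dots> = (\<integral>\<^sup>+z. ennreal ?C * (ennreal (cmod (f z) powr p) * indicator ?B z) \<partial>dA)"
    using meas by (simp add: nn_integral_cmult)
  also have "\<dots> \<le> (\<integral>\<^sup>+z. ennreal (carleson_const p R * cmod (f z) powr p / (1 - cmod z)\<^sup>2) *
          indicator (pseudohyperbolic_disc w R) z \<partial>dA)"
  proof (rule nn_integral_mono)
    fix z
    show "ennreal ?C * (ennreal (cmod (f z) powr p) * indicator ?B z)
       \<le> ennreal (carleson_const p R * cmod (f z) powr p / (1 - cmod z)\<^sup>2) *
          indicator (pseudohyperbolic_disc w R) z"
    proof (cases "z \<in> ?B")
      case True
      then have zE: "z \<in> pseudohyperbolic_disc w R"
        using ball_subset_pseudohyperbolic_disc[OF w R] d_def by auto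
      then have z1: "cmod z < 1" using mem_pseudohyperbolic_disc[OF w] by auto
      have "1 - cmod z \<le> 2 / (1 - R) * d"
        using pseudohyperbolic_disc_boundary_dist(2)[OF w R zE] d_def by simp
      then have "(1 - cmod z)\<^sup>2 \<le> (2 / (1 - R) * d)\<^sup>2" using z1 by (intro power_mono) auto
      then have "(1 - cmod z)\<^sup>2 \<le> (2 / (1 - R))\<^sup>2 * d\<^sup>2" by (simp only: power_mult_distrib)
      then have "1 / d\<^sup>2 \<le> (2 / (1 - R))\<^sup>2 / (1 - cmod z)\<^sup>2"
        using z1 d by (simp add: pos_le_divide_eq pos_divide_le_eq)
      then have "submean_const p / R\<^sup>2 * (1 / d\<^sup>2) \<le> submean_const p / R\<^sup>2 * ((2 / (1 - R))\<^sup>2 / (1 - cmod z)\<^sup>2)"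
        using submean_const_pos[of p] by (intro mult_left_mono) auto
      then have "?C \<le> carleson_const p R / (1 - cmod z)\<^sup>2"
        by (simp add: carleson_const_def power_mult_distrib)
      then have "?C * cmod (f z) powr p \<le> carleson_const p R / (1 - cmod z)\<^sup>2 * cmod (f z) powr p"
        by (rule mult_right_mono) simp
      then show ?thesis
        using True zE C0 by (simp flip: ennreal_mult add: ennreal_leI)
    qed simp
  qed
  finally show ?thesis .
qed

text \<open>Bounded sets of the Bergman space are locally uniformly bounded, as needed for Montel's theorem.\<close>

lemma holomorphic_pointwise_bound:
  assumes holf: "f holomorphic_on unit_disc" and p: "0 < p" and w: "cmod w < 1"
    and B: "(\<integral>\<^sup>+z. ennreal (cmod (f z) powr p) \<partial>dA) \<le> ennreal B" "0 \<le> B"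
  shows "cmod (f w) \<le> (submean_const p * B / (1 - cmod w)\<^sup>2) powr (1 / p)"
proof -
  define d where "d = 1 - cmod w"
  have d: "0 < d" using w by (simp add: d_def)
  have "ball w (1 * (1 - cmod w)) \<subseteq> unit_disc" using ball_subset_unit_disc[OF w, of 1] by simp
  then have sub: "ball w d \<subseteq> unit_disc" by (simp add: d_def)
  have "ennreal (cmod (f w) powr p * d\<^sup>2) \<le> ennreal (submean_const p) *
        (\<integral>\<^sup>+z. ennreal (cmod (f z) powr p) * indicator (ball w d) z \<partial>dA)"
    unfolding submean_const_def by (rule holomorphic_powr_submean[OF holf sub d p])
  also have "\<dots> \<le> ennreal (submean_const p) * (\<integral>\<^sup>+z. ennreal (cmod (f z) powr p) \<partial>dA)"
    by (intro mult_left_mono nn_integral_mono) (auto simp: indicator_def)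
  also have "\<dots> \<le> ennreal (submean_const p) * ennreal B"
    using B by (intro mult_left_mono) auto
  also have "\<dots> = ennreal (submean_const p * B)"
    using submean_const_pos[of p] B by (simp flip: ennreal_mult)
  finally have "cmod (f w) powr p * d\<^sup>2 \<le> submean_const p * B"
    using submean_const_pos[of p] B by (subst (asm) ennreal_le_iff) auto
  then have "cmod (f w) powr p \<le> submean_const p * B / d\<^sup>2" using d by (simp add: pos_le_divide_eq)
  then have "(cmod (f w) powr p) powr (1 / p) \<le> (submean_const p * B / d\<^sup>2) powr (1 / p)"
    using p by (intro powr_mono2) auto
  then show ?thesis using p by (simp add: powr_powr d_def)
qed

lemma measurable_ident_dA: "sets \<mu> = sets dA \<Longrightarrow> (\<lambda>z. z) \<in> borel_measurable \<mu>"
  using measurable_dA_continuous[OF continuous_on_id] measurable_cong_sets by blast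

text \<open>Integrate \<open>holomorphic_powr_le_disc_integral\<close> over \<open>|w| > \<rho>\<close> with respect to \<open>\<mu>\<close> and exchange the
integrals. Since \<open>z \<in> E w R\<close> holds iff \<open>w \<in> E z R\<close>, the inner integral becomes \<open>\<mu> (E z R)\<close> divided by
\<open>(1 - |z|)\<^sup>2\<close>, which is at most \<open>\<epsilon>\<close>. The condition on \<open>\<rho>\<close> ensures that only those \<open>z\<close> occur at which
the hypothesis on \<open>\<mu>\<close> is available.\<close>

lemma carleson_tail_bound:
  assumes fin: "finite_measure \<mu>" and mu: "sets \<mu> = sets dA"
    and holf: "f holomorphic_on unit_disc" and p: "0 < p" and R: "0 < R" "R < 1" and eps: "0 \<le> \<epsilon>"
    and small: "\<And>z. \<rho>0 < cmod z \<Longrightarrow> cmod z < 1 \<Longrightarrow>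
       emeasure \<mu> (pseudohyperbolic_disc z R) \<le> ennreal (\<epsilon> * (1 - cmod z)\<^sup>2)"
    and \<rho>: "2 / (1 - R) * (1 - \<rho>) \<le> 1 - \<rho>0"
  shows "(\<integral>\<^sup>+w. ennreal (cmod (f w) powr p) * indicator {w. \<rho> < cmod w} w \<partial>\<mu>)
     \<le> ennreal (carleson_const p R * \<epsilon>) * (\<integral>\<^sup>+z. ennreal (cmod (f z) powr p) \<partial>dA)"
proof -
  interpret mu: finite_measure \<mu> by fact
  interpret dA: finite_measure dA by (rule finite_measure_dA)
  interpret pair_sigma_finite \<mu> dA ..
  note K = carleson_const_pos[OF R, of p]
  have sp: "space \<mu> = unit_disc" using sets_eq_imp_space_eq[OF mu] by simp
  define g where "g z = ennreal (carleson_const p R * cmod (f z) powr p / (1 - cmod z)\<^sup>2)" for z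
  define H where "H x = (if \<rho> < cmod (fst x) \<and>
      cmod (fst x - snd x) < R * cmod (1 - cnj (fst x) * snd x) then g (snd x) else 0)" for x
  note [measurable] = measurable_ident_dA[OF mu] measurable_ident_dA[OF refl]
    holomorphic_powr_measurable[OF holf, of p]
  have [measurable]: "cnj \<in> borel_measurable borel"
    by (intro borel_measurable_continuous_onI continuous_intros)
  have gm [measurable]: "g \<in> borel_measurable dA" unfolding g_def by measurable
  have f1: "fst \<in> borel_measurable (\<mu> \<Otimes>\<^sub>M dA)"
    using measurable_comp[OF measurable_fst measurable_ident_dA[OF mu]] by (simp add: comp_def)
  have f2: "snd \<in> borel_measurable (\<mu> \<Otimes>\<^sub>M dA)"
    using measurable_comp[OF measurable_snd measurable_ident_dA[OF refl]] by (simp add: comp_def)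
  have f3: "(\<lambda>x. cnj (fst x)) \<in> borel_measurable (\<mu> \<Otimes>\<^sub>M dA)"
    using measurable_comp[OF f1, of cnj borel] by (simp add: comp_def)
  have Hm: "H \<in> borel_measurable (\<mu> \<Otimes>\<^sub>M dA)"
    unfolding H_def using f1 f2 f3 by measurable
  have "(\<integral>\<^sup>+w. ennreal (cmod (f w) powr p) * indicator {w. \<rho> < cmod w} w \<partial>\<mu>)
      \<le> (\<integral>\<^sup>+w. \<integral>\<^sup>+z. H (w, z) \<partial>dA \<partial>\<mu>)"
  proof (rule nn_integral_mono)
    fix w assume "w \<in> space \<mu>"
    then have w: "cmod w < 1" using sp by simp
    show "ennreal (cmod (f w) powr p) * indicator {w. \<rho> < cmod w} w \<le> (\<integral>\<^sup>+z. H (w, z) \<partial>dA)"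
    proof (cases "\<rho> < cmod w")
      case True
      then have "ennreal (cmod (f w) powr p) * indicator {w. \<rho> < cmod w} w
          \<le> (\<integral>\<^sup>+z. g z * indicator (pseudohyperbolic_disc w R) z \<partial>dA)"
        using holomorphic_powr_le_disc_integral[OF holf p R w] by (simp add: g_def)
      also have "\<dots> = (\<integral>\<^sup>+z. H (w, z) \<partial>dA)"
        using True by (intro nn_integral_cong)
          (auto simp: H_def mem_pseudohyperbolic_disc[OF w] indicator_def)
      finally show ?thesis .
    qed simp
  qed
  also have "\<dots> = (\<integral>\<^sup>+z. \<integral>\<^sup>+w. H (w, z) \<partial>\<mu> \<partial>dA)" by (rule Fubini[OF Hm, symmetric])
  also have "\<dots> \<le> (\<integral>\<^sup>+z. ennreal (carleson_const p R * \<epsilon>) * ennreal (cmod (f z) powr p) \<partial>dA)"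
  proof (rule nn_integral_mono)
    fix z assume "z \<in> space dA"
    then have z: "cmod z < 1" by simp
    let ?E = "pseudohyperbolic_disc z R"
    have E: "?E \<in> sets \<mu>" using mu z pseudohyperbolic_disc_in_sets by simp
    show "(\<integral>\<^sup>+w. H (w, z) \<partial>\<mu>) \<le> ennreal (carleson_const p R * \<epsilon>) * ennreal (cmod (f z) powr p)"
    proof (cases "\<rho>0 < cmod z")
      case True
      have "(\<integral>\<^sup>+w. H (w, z) \<partial>\<mu>) \<le> (\<integral>\<^sup>+w. g z * indicator ?E w \<partial>\<mu>)"
        using sp by (intro nn_integral_mono)
          (auto simp: H_def mem_pseudohyperbolic_disc[OF z] indicator_def norm_minus_commute
            norm_one_minus_cnj_commute[of z])
      also have "\<dots> = g z * emeasure \<mu> ?E" using E by (simp add: nn_integral_cmult_indicator)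
      also have "\<dots> \<le> g z * ennreal (\<epsilon> * (1 - cmod z)\<^sup>2)"
        using small[OF True z] by (rule mult_left_mono) simp
      also have "\<dots> = ennreal (carleson_const p R * \<epsilon>) * ennreal (cmod (f z) powr p)"
        using K eps z unfolding g_def by (simp flip: ennreal_mult)
      finally show ?thesis .
    next
      case False
      have "H (w, z) = 0" if "w \<in> space \<mu>" for w
      proof (rule ccontr)
        assume "H (w, z) \<noteq> 0"
        then have w: "\<rho> < cmod w" "z \<in> pseudohyperbolic_disc w R"
          using that sp z by (auto simp: H_def mem_pseudohyperbolic_disc split: if_splits)
        have "1 - cmod z \<le> 2 / (1 - R) * (1 - cmod w)"
          using w that sp by (intro pseudohyperbolic_disc_boundary_dist(2)[OF _ R]) auto
        also have "\<dots> < 2 / (1 - R) * (1 - \<rho>)"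
          using w R by (intro mult_strict_left_mono) auto
        finally show False using \<rho> False by simp
      qed
      then have "(\<integral>\<^sup>+w. H (w, z) \<partial>\<mu>) = (\<integral>\<^sup>+w. 0 \<partial>\<mu>)" by (intro nn_integral_cong) auto
      then show ?thesis by simp
    qed
  qed
  also have "\<dots> = ennreal (carleson_const p R * \<epsilon>) * (\<integral>\<^sup>+z. ennreal (cmod (f z) powr p) \<partial>dA)"
    by (intro nn_integral_cmult) measurable
  finally show ?thesis .
qed

lemma tendsto_zero_ennreal_iff:
  fixes f :: "'a \<Rightarrow> ennreal"
  shows "(f \<longlongrightarrow> 0) F \<longleftrightarrow> (\<forall>e>0. \<forall>\<^sub>F x in F. f x \<le> ennreal e)"
proof
  assume f: "(f \<longlongrightarrow> 0) F"
  show "\<forall>e>0. \<forall>\<^sub>F x in F. f x \<le> ennreal e"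
  proof (intro allI impI)
    fix e :: real assume "0 < e"
    then have "\<forall>\<^sub>F x in F. f x < ennreal e" using f by (intro order_tendstoD(2)[of f 0]) auto
    then show "\<forall>\<^sub>F x in F. f x \<le> ennreal e" by eventually_elim simp
  qed
next
  assume *: "\<forall>e>0. \<forall>\<^sub>F x in F. f x \<le> ennreal e"
  show "(f \<longlongrightarrow> 0) F"
  proof (rule tendsto_zero_ennreal)
    fix r :: real assume r: "0 < r"
    then have "\<forall>\<^sub>F x in F. f x \<le> ennreal (r / 2)" using * by simp
    then show "\<forall>\<^sub>F x in F. f x < ennreal r"
      by eventually_elim (use r in \<open>auto simp: ennreal_less_iff elim: order_le_less_trans\<close>)
  qed
qed

text \<open>Near the circle the integrals are small by \<open>carleson_tail_bound\<close>, uniformly in \<open>k\<close>; on the remaining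
compact disc they tend to \<open>0\<close> because the convergence is uniform and \<open>\<mu>\<close> is finite.\<close>

lemma vanishing_on_discs_tendsto:
  assumes fin: "finite_measure \<mu>" and mu: "sets \<mu> = sets dA"
    and van: "vanishing_on_discs \<mu> R" and R: "0 < R" "R < 1" and p: "0 < p"
    and hol: "\<And>k. F k holomorphic_on unit_disc"
    and B: "\<And>k. (\<integral>\<^sup>+z. ennreal (cmod (F k z) powr p) \<partial>dA) \<le> ennreal B" "0 \<le> B"
    and lim: "\<And>K. compact K \<Longrightarrow> K \<subseteq> unit_disc \<Longrightarrow> uniform_limit K F (\<lambda>_. 0) sequentially"
  shows "(\<lambda>k. \<integral>\<^sup>+w. ennreal (cmod (F k w) powr p) \<partial>\<mu>) \<longlonglongrightarrow> 0"
  unfolding tendsto_zero_ennreal_iff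
proof (intro allI impI)
  fix e :: real assume e: "0 < e"
  interpret mu: finite_measure \<mu> by fact
  have sp: "space \<mu> = unit_disc" using sets_eq_imp_space_eq[OF mu] by simp
  note K = carleson_const_pos[OF R, of p]
  define \<epsilon> where "\<epsilon> = e / (2 * (carleson_const p R * (B + 1)))"
  have \<epsilon>: "0 < \<epsilon>" "carleson_const p R * \<epsilon> * B \<le> e / 2"
    using e K B by (auto simp: \<epsilon>_def divide_simps)
  obtain \<rho>0 where \<rho>0: "\<rho>0 < 1" and small: "\<And>z. \<rho>0 < cmod z \<Longrightarrow> cmod z < 1 \<Longrightarrow>
       emeasure \<mu> (pseudohyperbolic_disc z R) \<le> ennreal (\<epsilon> * (1 - cmod z)\<^sup>2)"
    using van \<epsilon>(1) unfolding vanishing_on_discs_def by blast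
  define \<rho> where "\<rho> = 1 - (1 - R) / 2 * (1 - \<rho>0)"
  have "0 < (1 - R) / 2 * (1 - \<rho>0)" using R \<rho>0 by simp
  then have \<rho>: "\<rho> < 1" "2 / (1 - R) * (1 - \<rho>) \<le> 1 - \<rho>0" using R by (auto simp: \<rho>_def)
  define m where "m = measure \<mu> (space \<mu>)"
  \<comment> \<open>Chosen so that \<open>\<eta> powr p\<close> integrates to at most \<open>e / 2\<close>; the summand \<open>1\<close> covers a null measure.\<close>
  define \<eta> where "\<eta> = (e / (2 * (m + 1))) powr (1 / p)"
  have m: "0 \<le> m" by (simp add: m_def)
  have \<eta>: "0 < \<eta>" "\<eta> powr p * m \<le> e / 2"
  proof -
    show "0 < \<eta>" using e m by (simp add: \<eta>_def)
    have "\<eta> powr p = e / (2 * (m + 1))" using e m p by (simp add: \<eta>_def powr_powr)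
    also have "\<dots> * m \<le> e / 2" using e m by (auto simp: field_simps)
    finally show "\<eta> powr p * m \<le> e / 2" .
  qed
  have "compact (cball (0::complex) \<rho>)" "cball (0::complex) \<rho> \<subseteq> unit_disc" using \<rho> by auto
  from lim[OF this] have "\<forall>\<^sub>F k in sequentially. \<forall>w\<in>cball 0 \<rho>. cmod (F k w) < \<eta>"
    using \<eta>(1) by (simp add: uniform_limit_iff dist_norm)
  then show "\<forall>\<^sub>F k in sequentially. (\<integral>\<^sup>+w. ennreal (cmod (F k w) powr p) \<partial>\<mu>) \<le> ennreal e"
  proof eventually_elim
    case (elim k)
    have meas: "(\<lambda>w. cmod (F k w) powr p) \<in> borel_measurable \<mu>"
      using holomorphic_powr_measurable[OF hol] mu measurable_cong_sets by blast
    note [measurable] = measurable_ident_dA[OF mu] meas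
    have "(\<integral>\<^sup>+w. ennreal (cmod (F k w) powr p) \<partial>\<mu>)
        \<le> (\<integral>\<^sup>+w. ennreal (cmod (F k w) powr p) * indicator {w. \<rho> < cmod w} w + ennreal (\<eta> powr p) \<partial>\<mu>)"
    proof (rule nn_integral_mono)
      fix w assume "w \<in> space \<mu>"
      show "ennreal (cmod (F k w) powr p)
        \<le> ennreal (cmod (F k w) powr p) * indicator {w. \<rho> < cmod w} w + ennreal (\<eta> powr p)"
      proof (cases "\<rho> < cmod w")
        case False
        then have "cmod (F k w) powr p \<le> \<eta> powr p" using elim p by (intro powr_mono2) (auto simp: less_imp_le)
        then show ?thesis using False by (simp add: ennreal_leI)
      qed simp
    qed
    also have "\<dots> = (\<integral>\<^sup>+w. ennreal (cmod (F k w) powr p) * indicator {w. \<rho> < cmod w} w \<partial>\<mu>)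
        + ennreal (\<eta> powr p) * emeasure \<mu> (space \<mu>)"
      by (subst nn_integral_add) auto
    also have "\<dots> \<le> ennreal (e / 2) + ennreal (e / 2)"
    proof (rule add_mono)
      have "(\<integral>\<^sup>+w. ennreal (cmod (F k w) powr p) * indicator {w. \<rho> < cmod w} w \<partial>\<mu>)
         \<le> ennreal (carleson_const p R * \<epsilon>) * (\<integral>\<^sup>+z. ennreal (cmod (F k z) powr p) \<partial>dA)"
        using \<epsilon> by (intro carleson_tail_bound[OF fin mu hol p R _ small \<rho>(2)]) auto
      also have "\<dots> \<le> ennreal (carleson_const p R * \<epsilon>) * ennreal B"
        using B by (intro mult_left_mono) auto
      also have "\<dots> \<le> ennreal (e / 2)"
        using \<epsilon> K B by (simp add: ennreal_leI flip: ennreal_mult)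
      finally show "(\<integral>\<^sup>+w. ennreal (cmod (F k w) powr p) * indicator {w. \<rho> < cmod w} w \<partial>\<mu>)
         \<le> ennreal (e / 2)" .
      show "ennreal (\<eta> powr p) * emeasure \<mu> (space \<mu>) \<le> ennreal (e / 2)"
        using \<eta> m by (simp add: mu.emeasure_eq_measure ennreal_leI flip: ennreal_mult m_def)
    qed
    also have "\<dots> = ennreal e" using e by (simp flip: ennreal_plus)
    finally show ?case .
  qed
qed

section \<open>The quotients with the weight removed\<close>

lemma eventually_to_unit_circle:
  "eventually P to_unit_circle \<longleftrightarrow> (\<exists>\<rho><1. \<forall>z. \<rho> < cmod z \<and> cmod z < 1 \<longrightarrow> P z)"
  unfolding to_unit_circle_def eventually_filtercomap eventually_at_left_field
proof
  assume "\<exists>Q. (\<exists>b<1. \<forall>y>b. y < 1 \<longrightarrow> Q y) \<and> (\<forall>z. Q (cmod z) \<longrightarrow> P z)"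
  then show "\<exists>\<rho><1. \<forall>z. \<rho> < cmod z \<and> cmod z < 1 \<longrightarrow> P z" by blast
next
  assume "\<exists>\<rho><1. \<forall>z. \<rho> < cmod z \<and> cmod z < 1 \<longrightarrow> P z"
  then obtain \<rho> where "\<rho> < 1" "\<And>z. \<rho> < cmod z \<and> cmod z < 1 \<Longrightarrow> P z" by blast
  then show "\<exists>Q. (\<exists>b<1. \<forall>y>b. y < 1 \<longrightarrow> Q y) \<and> (\<forall>z. Q (cmod z) \<longrightarrow> P z)"
    by (intro exI[of _ "\<lambda>x. \<rho> < x \<and> x < 1"]) auto
qed

lemma vanishing_on_discs_altdef:
  "vanishing_on_discs \<mu> R \<longleftrightarrow> (\<forall>\<epsilon>>0. \<forall>\<^sub>F z in to_unit_circle.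
     emeasure \<mu> (pseudohyperbolic_disc z R) \<le> ennreal (\<epsilon> * (1 - cmod z)\<^sup>2))"
  by (simp add: vanishing_on_discs_def eventually_to_unit_circle)

lemma vanishing_on_discs_if_berezin:
  assumes mu: "sets \<mu> = sets dA" and s: "0 < s" and R: "0 < R" "R < 1"
    and ber: "((\<lambda>a. \<integral>\<^sup>+w. ennreal (berezin_density s a w) \<partial>\<mu>) \<longlongrightarrow> 0) to_unit_circle"
  shows "vanishing_on_discs \<mu> R"
  unfolding vanishing_on_discs_altdef
proof (intro allI impI)
  fix \<epsilon> :: real assume \<epsilon>: "0 < \<epsilon>"
  define c where "c = (2 / (1 - R)) powr s"
  have c: "0 < c" using R by (simp add: c_def)
  have "\<forall>\<^sub>F a in to_unit_circle. (\<integral>\<^sup>+w. ennreal (berezin_density s a w) \<partial>\<mu>) \<le> ennreal (\<epsilon> / c)"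
    using ber \<epsilon> c unfolding tendsto_zero_ennreal_iff by simp
  moreover have "\<forall>\<^sub>F a in to_unit_circle. cmod a < 1"
    unfolding eventually_to_unit_circle by (intro exI[of _ 0]) auto
  ultimately show "\<forall>\<^sub>F a in to_unit_circle.
      emeasure \<mu> (pseudohyperbolic_disc a R) \<le> ennreal (\<epsilon> * (1 - cmod a)\<^sup>2)"
  proof eventually_elim
    case (elim a)
    have "emeasure \<mu> (pseudohyperbolic_disc a R)
        \<le> ennreal (c * (1 - cmod a)\<^sup>2) * (\<integral>\<^sup>+w. ennreal (berezin_density s a w) \<partial>\<mu>)"
      unfolding c_def using emeasure_pseudohyperbolic_disc_le_berezin[OF mu elim(2) R s] .
    also have "\<dots> \<le> ennreal (c * (1 - cmod a)\<^sup>2) * ennreal (\<epsilon> / c)"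
      using elim(1) by (rule mult_left_mono) simp
    also have "\<dots> = ennreal (\<epsilon> * (1 - cmod a)\<^sup>2)"
      using c \<epsilon> by (simp add: mult.commute flip: ennreal_mult)
    finally show ?case .
  qed
qed

lemma ennreal_divide_le_iff:
  assumes "0 < v" "0 \<le> e"
  shows "X / ennreal v \<le> ennreal e \<longleftrightarrow> X \<le> ennreal (e * v)"
proof (cases X)
  case (real x)
  then show ?thesis using assms by (simp add: divide_ennreal field_simps)
next
  case top
  then show ?thesis using assms by (simp add: ennreal_top_divide top_unique)
qed

text \<open>The area of the disc is comparable to the square of the boundary distance, and \<open>\<sigma>\<close> lies
between positive constants. A general filter is used so that the same statement serves the limit at
the circle and the limit along a lattice.\<close>

lemma averaging_tendsto_iff:
  assumes mu: "sets \<mu> = sets dA" and r: "0 < r" "r < 1"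
    and m: "0 < m" and \<sigma>: "\<forall>x\<in>{0..1}. m \<le> \<sigma> x \<and> \<sigma> x \<le> S"
    and z: "\<forall>\<^sub>F x in F. cmod (z x) < 1"
  shows "((\<lambda>x. averaging r \<mu> (z x) / ennreal (\<sigma> (cmod (z x)))) \<longlongrightarrow> 0) F \<longleftrightarrow>
    (\<forall>\<epsilon>>0. \<forall>\<^sub>F x in F. emeasure \<mu> (pseudohyperbolic_disc (z x) r) \<le> ennreal (\<epsilon> * (1 - cmod (z x))\<^sup>2))"
proof -
  define b where "b = (2 / (1 - r))\<^sup>2"
  have b: "0 < b" using r by (simp add: b_def)
  have S: "0 < S" using m bspec[OF \<sigma>, of 0] by simp
  have key: "(averaging r \<mu> a / ennreal (\<sigma> (cmod a)) \<le> ennreal e \<longrightarrow>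
        emeasure \<mu> (pseudohyperbolic_disc a r) \<le> ennreal (e * (S * b) * (1 - cmod a)\<^sup>2)) \<and>
      (emeasure \<mu> (pseudohyperbolic_disc a r) \<le> ennreal (e * (m * r\<^sup>2) * (1 - cmod a)\<^sup>2) \<longrightarrow>
        averaging r \<mu> a / ennreal (\<sigma> (cmod a)) \<le> ennreal e)"
    if a: "cmod a < 1" and e: "0 < e" for a e
  proof -
    let ?X = "emeasure \<mu> (pseudohyperbolic_disc a r)" and ?d = "1 - cmod a"
    define v where "v = enn2real (emeasure dA (pseudohyperbolic_disc a r))"
    have "emeasure dA (pseudohyperbolic_disc a r) < top"
      using emeasure_dA_pseudohyperbolic_disc_le[OF a r] by (simp add: order_le_less_trans)
    then have v: "emeasure dA (pseudohyperbolic_disc a r) = ennreal v" "0 \<le> v" by (auto simp: v_def)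
    have vu: "v \<le> b * ?d\<^sup>2"
      using emeasure_dA_pseudohyperbolic_disc_le[OF a r] v
      unfolding b_def power_mult_distrib by (subst (asm) v(1)) simp
    have vl: "r\<^sup>2 * ?d\<^sup>2 \<le> v"
      using emeasure_dA_pseudohyperbolic_disc_ge[OF a r] v
      by (simp add: power_mult_distrib)
    have "0 < r\<^sup>2 * ?d\<^sup>2" using r a by simp
    then have v0: "0 < v" using vl by linarith
    have s: "m \<le> \<sigma> (cmod a)" "\<sigma> (cmod a) \<le> S" using bspec[OF \<sigma>, of "cmod a"] a by auto
    have "averaging r \<mu> a / ennreal (\<sigma> (cmod a)) \<le> ennreal e \<longleftrightarrow> ?X / ennreal v \<le> ennreal (e * \<sigma> (cmod a))"
      unfolding averaging_def v(1) using s m e by (intro ennreal_divide_le_iff) auto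
    also have "\<dots> \<longleftrightarrow> ?X \<le> ennreal (e * \<sigma> (cmod a) * v)"
      using s m e v0 by (intro ennreal_divide_le_iff) auto
    finally have eq: "averaging r \<mu> a / ennreal (\<sigma> (cmod a)) \<le> ennreal e
      \<longleftrightarrow> ?X \<le> ennreal (e * \<sigma> (cmod a) * v)" .
    have "e * (\<sigma> (cmod a) * v) \<le> e * (S * (b * ?d\<^sup>2))"
      using s m e v0 vu S by (intro mult_left_mono mult_mono) auto
    moreover have "e * (m * (r\<^sup>2 * ?d\<^sup>2)) \<le> e * (\<sigma> (cmod a) * v)"
      using s m e v0 vl S by (intro mult_left_mono mult_mono) auto
    ultimately show ?thesis
      unfolding eq by (auto simp: mult.assoc intro: order_trans ennreal_leI)
  qed
  show ?thesis
    unfolding tendsto_zero_ennreal_iff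
  proof (intro iffI allI impI)
    fix \<epsilon> :: real
    assume *: "\<forall>e>0. \<forall>\<^sub>F x in F. averaging r \<mu> (z x) / ennreal (\<sigma> (cmod (z x))) \<le> ennreal e" and "0 < \<epsilon>"
    then have e: "0 < \<epsilon> / (S * b)" using S b by simp
    with * have "\<forall>\<^sub>F x in F. averaging r \<mu> (z x) / ennreal (\<sigma> (cmod (z x))) \<le> ennreal (\<epsilon> / (S * b))" by blast
    with z show "\<forall>\<^sub>F x in F. emeasure \<mu> (pseudohyperbolic_disc (z x) r) \<le> ennreal (\<epsilon> * (1 - cmod (z x))\<^sup>2)"
    proof eventually_elim
      case (elim x)
      then show ?case using key[OF elim(1) e] S b by simp
    qed
  next
    fix e :: real
    assume *: "\<forall>\<epsilon>>0. \<forall>\<^sub>F x in F. emeasure \<mu> (pseudohyperbolic_disc (z x) r) \<le> ennreal (\<epsilon> * (1 - cmod (z x))\<^sup>2)"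
      and e: "0 < e"
    have "0 < e * (m * r\<^sup>2)" using e m r by simp
    with * have "\<forall>\<^sub>F x in F. emeasure \<mu> (pseudohyperbolic_disc (z x) r)
        \<le> ennreal (e * (m * r\<^sup>2) * (1 - cmod (z x))\<^sup>2)" by blast
    with z show "\<forall>\<^sub>F x in F. averaging r \<mu> (z x) / ennreal (\<sigma> (cmod (z x))) \<le> ennreal e"
    proof eventually_elim
      case (elim x)
      then show ?case using key[OF elim(1) e] by simp
    qed
  qed
qed

text \<open>\<open>K(z,z) = (1 - |z|\<^sup>2) powr - (\<alpha> + 2)\<close>, and its root, in the denominator, produces the first factor.
The second one compensates the factor \<open>(1 - |z|) powr (s - 2)\<close> in the density.\<close>

lemma norm_normalized_kernel_powr:
  assumes z: "cmod z < 1" and w: "cmod w < 1"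
  shows "cmod (normalized_kernel \<alpha> z w) powr t =
    (1 - (cmod z)\<^sup>2) powr ((\<alpha> + 2) * t / 2) * (1 - cmod z) powr (2 - (\<alpha> + 2) * t) *
      berezin_density ((\<alpha> + 2) * t) z w"
proof -
  define s where "s = (\<alpha> + 2) * t"
  have d: "0 < 1 - cmod z" using z by simp
  have d2: "0 < 1 - (cmod z)\<^sup>2" using z by (simp add: power_less_one_iff)
  have kn: "cmod (bergman_kernel \<alpha> x y) = cmod (1 - cnj y * x) powr (- (\<alpha> + 2))" for x y
    unfolding bergman_kernel_def by (subst norm_powr_real_powr') auto
  have "cmod (1 - cnj z * z) = 1 - (cmod z)\<^sup>2"
  proof -
    have "1 - cnj z * z = complex_of_real (1 - (cmod z)\<^sup>2)"
      by (metis complex_norm_square mult.commute of_real_1 of_real_diff)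
    then show ?thesis using d2 by (metis abs_of_pos norm_of_real)
  qed
  then have "cmod (normalized_kernel \<alpha> z w)
      = cmod (1 - cnj z * w) powr (- (\<alpha> + 2)) / sqrt ((1 - (cmod z)\<^sup>2) powr (- (\<alpha> + 2)))"
    unfolding normalized_kernel_def norm_divide norm_csqrt kn
    by (simp add: norm_one_minus_cnj_commute[of w z])
  also have "sqrt ((1 - (cmod z)\<^sup>2) powr (- (\<alpha> + 2))) = (1 - (cmod z)\<^sup>2) powr (- ((\<alpha> + 2) / 2))"
    by (simp only: powr_half_sqrt[OF powr_ge_zero, symmetric] powr_powr mult_minus_left
        times_divide_eq_right mult_1_right minus_divide_left)
  finally have "cmod (normalized_kernel \<alpha> z w) =
      cmod (1 - cnj z * w) powr (- (\<alpha> + 2)) * (1 - (cmod z)\<^sup>2) powr ((\<alpha> + 2) / 2)"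
    by (simp only: powr_minus divide_inverse inverse_inverse_eq)
  then have "cmod (normalized_kernel \<alpha> z w) powr t =
      cmod (1 - cnj z * w) powr (- (\<alpha> + 2) * t) * (1 - (cmod z)\<^sup>2) powr ((\<alpha> + 2) / 2 * t)"
    by (simp only: powr_mult powr_powr)
  also have "- (\<alpha> + 2) * t = - s" by (simp only: s_def mult_minus_left)
  also have "(\<alpha> + 2) / 2 * t = s / 2" by (simp only: s_def times_divide_eq_left)
  finally have "cmod (normalized_kernel \<alpha> z w) powr t =
      (1 - (cmod z)\<^sup>2) powr (s / 2) * cmod (1 - cnj z * w) powr (- s)"
    by (simp only: mult.commute)
  moreover have "(1 - cmod z) powr (2 - s) * (1 - cmod z) powr (s - 2) = 1"
    using d by (simp flip: powr_add)
  ultimately show ?thesis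
    unfolding s_def[symmetric] berezin_density_def
    by (metis mult.assoc mult_1 powr_minus_divide times_divide_eq_right)
qed

text \<open>The powers of \<open>1 - |z|\<close> cancel, and of \<open>(1 - |z|\<^sup>2) = (1 + |z|) (1 - |z|)\<close> only the harmless factor
\<open>1 + |z|\<close> survives.\<close>

lemma berezin_quotient_eq:
  assumes mu: "sets \<mu> = sets dA" and z: "cmod z < 1" and c: "0 < c"
  shows "berezin \<alpha> t \<mu> z / ennreal (c * (1 - (cmod z)\<^sup>2) powr (2 - (\<alpha> + 2) * t / 2)) =
    ennreal ((1 + cmod z) powr ((\<alpha> + 2) * t - 2) / c) *
      (\<integral>\<^sup>+w. ennreal (berezin_density ((\<alpha> + 2) * t) z w) \<partial>\<mu>)"
proof -
  define s where "s = (\<alpha> + 2) * t"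
  let ?I = "\<integral>\<^sup>+w. ennreal (berezin_density s z w) \<partial>\<mu>"
  let ?k = "(1 - (cmod z)\<^sup>2) powr (s / 2) * (1 - cmod z) powr (2 - s)"
  let ?q = "c * (1 - (cmod z)\<^sup>2) powr (2 - s / 2)"
  have d: "0 < 1 - cmod z" "0 < 1 + cmod z" using z by (auto intro: add_pos_nonneg)
  have d2: "0 < 1 - (cmod z)\<^sup>2" using z by (simp add: power_less_one_iff)
  have q: "0 < ?q" using c d2 by simp
  have sp: "space \<mu> = unit_disc" using sets_eq_imp_space_eq[OF mu] by simp
  have meas: "berezin_density s z \<in> borel_measurable \<mu>"
    using berezin_density_measurable[OF z] mu measurable_cong_sets by blast
  have "berezin \<alpha> t \<mu> z = (\<integral>\<^sup>+w. ennreal ?k * ennreal (berezin_density s z w) \<partial>\<mu>)"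
    unfolding berezin_def using sp norm_normalized_kernel_powr[OF z]
    by (intro nn_integral_cong) (auto simp: s_def ennreal_mult)
  also have "\<dots> = ennreal ?k * ?I" using meas by (intro nn_integral_cmult) auto
  finally have "berezin \<alpha> t \<mu> z / ennreal ?q = ennreal ?k * ?I / ennreal ?q" by simp
  also have "\<dots> = ennreal ?k / ennreal ?q * ?I"
    by (simp add: divide_ennreal_def mult.assoc mult.commute[of ?I] mult.left_commute)
  also have "ennreal ?k / ennreal ?q = ennreal (?k / ?q)"
    using q by (intro divide_ennreal) auto
  also have "?k / ?q = (1 + cmod z) powr (s - 2) / c"
  proof -
    have "1 - (cmod z)\<^sup>2 = (1 + cmod z) * (1 - cmod z)" by (simp add: power2_eq_square algebra_simps)
    then have pw: "(1 - (cmod z)\<^sup>2) powr e = (1 + cmod z) powr e * (1 - cmod z) powr e" for e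
      using d by (simp add: powr_mult)
    have "(1 - (cmod z)\<^sup>2) powr (s / 2) / (1 - (cmod z)\<^sup>2) powr (2 - s / 2) = (1 - (cmod z)\<^sup>2) powr (s - 2)"
      by (simp flip: powr_diff)
    moreover have "A * B / (c * C) = A / C * B / c" for A B C :: real
      by (simp add: mult.commute)
    ultimately have "?k / ?q = (1 - (cmod z)\<^sup>2) powr (s - 2) * (1 - cmod z) powr (2 - s) / c"
      by (simp only:)
    also have "\<dots> = (1 + cmod z) powr (s - 2) * ((1 - cmod z) powr (s - 2) * (1 - cmod z) powr (2 - s)) / c"
      by (simp add: pw)
    also have "(1 - cmod z) powr (s - 2) * (1 - cmod z) powr (2 - s) = 1"
      using d by (simp flip: powr_add)
    finally show ?thesis by simp
  qed
  finally show ?thesis by (simp add: s_def)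
qed

text \<open>For \<open>s \<ge> 2\<close> the factor in \<open>berezin_quotient_eq\<close> lies between \<open>1 / S\<close> and \<open>2 powr (s - 2) / m\<close>.\<close>

lemma berezin_tendsto_iff:
  assumes mu: "sets \<mu> = sets dA" and st: "2 \<le> (\<alpha> + 2) * t"
    and m: "0 < m" and \<sigma>: "\<forall>x\<in>{0..1}. m \<le> \<sigma> x \<and> \<sigma> x \<le> S"
  shows "((\<lambda>z. berezin \<alpha> t \<mu> z /
        ennreal (\<sigma> (cmod z) * (1 - (cmod z)\<^sup>2) powr (2 - (\<alpha> + 2) * t / 2))) \<longlongrightarrow> 0) to_unit_circle
    \<longleftrightarrow> ((\<lambda>z. \<integral>\<^sup>+w. ennreal (berezin_density ((\<alpha> + 2) * t) z w) \<partial>\<mu>) \<longlongrightarrow> 0) to_unit_circle"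
    (is "(?f \<longlongrightarrow> 0) _ \<longleftrightarrow> (?g \<longlongrightarrow> 0) _")
proof -
  define b where "b = 2 powr ((\<alpha> + 2) * t - 2) / m"
  have b: "0 < b" using m by (simp add: b_def)
  have S: "0 < S" using m bspec[OF \<sigma>, of 0] by simp
  have disc: "\<forall>\<^sub>F z in to_unit_circle. cmod z < 1"
    unfolding eventually_to_unit_circle by (intro exI[of _ 0]) auto
  have key: "?f z \<le> ennreal b * ?g z \<and> ?g z \<le> ennreal S * ?f z" if z: "cmod z < 1" for z
  proof -
    define k where "k = (1 + cmod z) powr ((\<alpha> + 2) * t - 2) / \<sigma> (cmod z)"
    have s: "m \<le> \<sigma> (cmod z)" "\<sigma> (cmod z) \<le> S" "0 < \<sigma> (cmod z)" using bspec[OF \<sigma>, of "cmod z"] m z by auto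
    have f: "?f z = ennreal k * ?g z" unfolding k_def using berezin_quotient_eq[OF mu z s(3)] .
    have "1 \<le> (1 + cmod z) powr ((\<alpha> + 2) * t - 2)" using st by (intro ge_one_powr_ge_zero) auto
    then have "1 / S \<le> k" unfolding k_def using s S by (intro frac_le) auto
    then have k1: "1 \<le> S * k" using S by (simp add: field_simps)
    have "(1 + cmod z) powr ((\<alpha> + 2) * t - 2) \<le> 2 powr ((\<alpha> + 2) * t - 2)"
      using z st by (intro powr_mono2) auto
    then have k2: "k \<le> b" unfolding k_def b_def using s m by (intro frac_le) auto
    have "?g z = 1 * ?g z" by simp
    also have "\<dots> \<le> ennreal (S * k) * ?g z"
      using k1 by (intro mult_right_mono) (auto simp flip: ennreal_1 intro: ennreal_leI)
    also have "\<dots> = ennreal S * ?f z"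
      using S by (simp only: f ennreal_mult'[OF less_imp_le] mult.assoc)
    finally have "?g z \<le> ennreal S * ?f z" .
    moreover have "?f z \<le> ennreal b * ?g z"
      unfolding f using k2 by (intro mult_right_mono ennreal_leI) auto
    ultimately show ?thesis by blast
  qed
  have transfer: "(h \<longlongrightarrow> 0) to_unit_circle"
    if "(h' \<longlongrightarrow> 0) to_unit_circle" and "\<And>z. cmod z < 1 \<Longrightarrow> h z \<le> ennreal c * h' z"
    for h h' :: "complex \<Rightarrow> ennreal" and c
  proof (rule tendsto_sandwich[of "\<lambda>_. 0"])
    show "\<forall>\<^sub>F z in to_unit_circle. h z \<le> ennreal c * h' z"
      using disc by eventually_elim (rule that(2))
    show "((\<lambda>z. ennreal c * h' z) \<longlongrightarrow> 0) to_unit_circle"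
      using ennreal_tendsto_cmult[OF _ that(1), of "ennreal c"] by simp
  qed auto
  show ?thesis
  proof
    assume "(?f \<longlongrightarrow> 0) to_unit_circle"
    then show "(?g \<longlongrightarrow> 0) to_unit_circle" by (rule transfer) (rule key[THEN conjunct2])
  next
    assume "(?g \<longlongrightarrow> 0) to_unit_circle"
    then show "(?f \<longlongrightarrow> 0) to_unit_circle" by (rule transfer) (rule key[THEN conjunct1])
  qed
qed

section \<open>Lattices\<close>

lemma pseudohyperbolic_disc_mono:
  "r \<le> r' \<Longrightarrow> pseudohyperbolic_disc a r \<subseteq> pseudohyperbolic_disc a r'"
  by (auto simp: pseudohyperbolic_disc_def)

lemma lattice_seq_in_disc:
  assumes "lattice_seq r z"
  shows "cmod (z k) < 1"
proof -
  have "range z \<subseteq> unit_disc" using assms unfolding lattice_seq_def by (rule conjunct1)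
  then have "z k \<in> unit_disc" by (rule subsetD) (rule rangeI)
  then show ?thesis by simp
qed

text \<open>Otherwise infinitely many lattice points lie in a compact disc. Cover it by finitely many balls so
small that the centre of a ball belongs to the enlarged pseudohyperbolic disc of each lattice point
in the ball; then one of the centres belongs to infinitely many enlarged discs.\<close>

lemma lattice_seq_to_unit_circle:
  assumes lat: "lattice_seq r z" and r: "0 < r" "r < 1"
  shows "filterlim z to_unit_circle sequentially"
proof -
  let ?R = "(1 + r) / 2"
  have R: "0 < ?R" "?R < 1" using r by auto
  have zd: "cmod (z k) < 1" for k using lattice_seq_in_disc[OF lat] .
  have fin: "finite {k. w \<in> pseudohyperbolic_disc (z k) ?R}" if "w \<in> unit_disc" for w
    using lat that unfolding lattice_seq_def by blast
  have finite_inside: "finite {k. cmod (z k) \<le> \<rho>}" if \<rho>: "\<rho> < 1" for \<rho>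
  proof -
    define e where "e = ?R * (1 - \<rho>)"
    have e: "0 < e" unfolding e_def using R \<rho> by (intro mult_pos_pos) auto
    have "cball (0::complex) \<rho> \<subseteq> (\<Union>x\<in>cball 0 \<rho>. ball x e)"
    proof
      fix x :: complex assume "x \<in> cball 0 \<rho>"
      then show "x \<in> (\<Union>x\<in>cball 0 \<rho>. ball x e)" using e by (intro UN_I[of x]) auto
    qed
    then obtain N where N: "N \<subseteq> cball (0::complex) \<rho>" "finite N" "cball 0 \<rho> \<subseteq> (\<Union>x\<in>N. ball x e)"
      by (rule compactE_image[OF compact_cball open_ball])
    have "{k. cmod (z k) \<le> \<rho>} \<subseteq> (\<Union>w\<in>N. {k. w \<in> pseudohyperbolic_disc (z k) ?R})"
    proof
      fix k assume "k \<in> {k. cmod (z k) \<le> \<rho>}"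
      then have k: "cmod (z k) \<le> \<rho>" by simp
      then obtain w where w: "w \<in> N" "z k \<in> ball w e" using N(3) by auto
      have "e \<le> ?R * (1 - cmod (z k))" unfolding e_def using k R by (intro mult_left_mono) auto
      then have "w \<in> ball (z k) (?R * (1 - cmod (z k)))" using w by (auto simp: dist_commute)
      then have "w \<in> pseudohyperbolic_disc (z k) ?R"
        using ball_subset_pseudohyperbolic_disc[OF zd R] by blast
      then show "k \<in> (\<Union>w\<in>N. {k. w \<in> pseudohyperbolic_disc (z k) ?R})" using w by blast
    qed
    moreover have "finite (\<Union>w\<in>N. {k. w \<in> pseudohyperbolic_disc (z k) ?R})"
      using N \<rho> by (intro finite_UN_I fin) auto
    ultimately show ?thesis by (rule finite_subset)
  qed
  show ?thesis
    unfolding filterlim_iff eventually_to_unit_circle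
  proof (intro allI impI)
    fix P assume "\<exists>\<rho><1. \<forall>w. \<rho> < cmod w \<and> cmod w < 1 \<longrightarrow> P w"
    then obtain \<rho> where \<rho>: "\<rho> < 1" "\<And>w. \<rho> < cmod w \<Longrightarrow> cmod w < 1 \<Longrightarrow> P w" by blast
    have "\<forall>\<^sub>F k in sequentially. \<not> cmod (z k) \<le> \<rho>"
      using finite_inside[OF \<rho>(1)] unfolding cofinite_eq_sequentially[symmetric] eventually_cofinite
      by simp
    then show "\<forall>\<^sub>F k in sequentially. P (z k)"
      by eventually_elim (use \<rho>(2) zd in auto)
  qed
qed

text \<open>The measure of \<open>E a R\<close> is at most the sum of the measures of the lattice discs that meet it, hence
at most a small multiple of the sum of their areas. That sum is the integral of the overlap
function, which is at most \<open>M\<close> and is supported in a ball of radius comparable to \<open>1 - |a|\<close>. So the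
number of these discs need not be estimated.\<close>

lemma lattice_vanishing_on_discs:
  assumes mu: "sets \<mu> = sets dA" and lat: "lattice_seq r z" and r: "0 < r" "r < 1"
    and R: "0 < R" "R < 1"
    and small: "\<And>\<epsilon>. 0 < \<epsilon> \<Longrightarrow> \<forall>\<^sub>F k in sequentially.
      emeasure \<mu> (pseudohyperbolic_disc (z k) r) \<le> ennreal (\<epsilon> * (1 - cmod (z k))\<^sup>2)"
  shows "vanishing_on_discs \<mu> R"
  unfolding vanishing_on_discs_def
proof (intro allI impI)
  fix \<epsilon> :: real assume \<epsilon>: "0 < \<epsilon>"
  have zd: "cmod (z k) < 1" for k using lattice_seq_in_disc[OF lat] .
  note lat' = lat[unfolded lattice_seq_def, THEN conjunct2]
  note cover = lat'[THEN conjunct1]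
  from lat'[THEN conjunct2] obtain M :: nat where M: "0 < M" and mult: "\<forall>w\<in>unit_disc.
      finite {k. w \<in> pseudohyperbolic_disc (z k) ((1 + r) / 2)} \<and>
      card {k. w \<in> pseudohyperbolic_disc (z k) ((1 + r) / 2)} \<le> M"
    by (elim exE conjE)
  define L where "L = 2 / (1 - r) * (2 / (1 - R))"
  have L: "0 < L" using r R by (simp add: L_def)
  define B where "B = 2 * (2 / (1 - r)) * L + 2 / (1 - R)"
  have B: "0 < B" unfolding B_def using r R L by (intro add_pos_pos mult_pos_pos) auto
  \<comment> \<open>The discs meeting \<open>E a R\<close> lie in a ball of radius \<open>B * (1 - |a|)\<close>, so the final bound is
    \<open>\<epsilon>' / r\<^sup>2 * M * (B * (1 - |a|))\<^sup>2\<close>, where \<open>r\<^sup>2\<close> comes from the lower bound on the areas.\<close>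
  define \<epsilon>' where "\<epsilon>' = \<epsilon> * r\<^sup>2 / (M * B\<^sup>2)"
  have \<epsilon>': "0 < \<epsilon>'" using \<epsilon> r M B by (simp add: \<epsilon>'_def)
  obtain N where N: "\<And>k. N \<le> k \<Longrightarrow>
      emeasure \<mu> (pseudohyperbolic_disc (z k) r) \<le> ennreal (\<epsilon>' * (1 - cmod (z k))\<^sup>2)"
    using small[OF \<epsilon>'] unfolding eventually_sequentially by blast
  \<comment> \<open>The smallness of \<open>\<mu>\<close> is known only for indices from \<open>N\<close> on. Lattice discs with smaller index stay
    away from the circle, hence do not meet \<open>E a R\<close> once \<open>L * (1 - |a|) < q\<close>.\<close>
  define q where "q = Min (insert 1 ((\<lambda>k. 1 - cmod (z k)) ` {..<N}))"
  have q: "0 < q" "\<And>k. k < N \<Longrightarrow> q \<le> 1 - cmod (z k)"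
    using zd unfolding q_def by auto
  show "\<exists>\<rho><1. \<forall>a. \<rho> < cmod a \<and> cmod a < 1 \<longrightarrow>
      emeasure \<mu> (pseudohyperbolic_disc a R) \<le> ennreal (\<epsilon> * (1 - cmod a)\<^sup>2)"
  proof (intro exI[of _ "1 - q / L"] conjI allI impI)
    show "1 - q / L < 1" using q L by simp
    fix a assume "1 - q / L < cmod a \<and> cmod a < 1"
    then have a: "L * (1 - cmod a) < q" "cmod a < 1" using L by (auto simp: field_simps)
    define d where "d = 1 - cmod a"
    have d: "0 < d" using a by (simp add: d_def)
    define J where "J = {k. pseudohyperbolic_disc (z k) r \<inter> pseudohyperbolic_disc a R \<noteq> {}}"
    have dist_J: "1 - cmod (z k) \<le> L * d" if "k \<in> J" for k
    proof -
      have "pseudohyperbolic_disc (z k) r \<inter> pseudohyperbolic_disc a R \<noteq> {}"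
        using that by (simp add: J_def)
      then obtain u where u: "u \<in> pseudohyperbolic_disc (z k) r" "u \<in> pseudohyperbolic_disc a R"
        by blast
      have "1 - cmod (z k) \<le> 2 / (1 - r) * (1 - cmod u)"
        using pseudohyperbolic_disc_boundary_dist(1)[OF zd r u(1)] .
      also have "\<dots> \<le> 2 / (1 - r) * (2 / (1 - R) * (1 - cmod a))"
        using pseudohyperbolic_disc_boundary_dist(2)[OF a(2) R u(2)] r by (intro mult_left_mono) auto
      finally show ?thesis by (simp add: L_def d_def)
    qed
    have JN: "N \<le> k" if "k \<in> J" for k
      using dist_J[OF that] q(2)[of k] a by (force simp: d_def)
    define A where "A k = (if k \<in> J then pseudohyperbolic_disc (z k) r else {})" for k
    have A: "A k \<in> sets dA" for k
      unfolding A_def using zd pseudohyperbolic_disc_in_sets by auto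
    have Asub: "A k \<subseteq> ball a (B * d)" for k
    proof
      fix x assume "x \<in> A k"
      then have k: "k \<in> J" and x: "x \<in> pseudohyperbolic_disc (z k) r"
        by (auto simp: A_def split: if_splits)
      then obtain u where u: "u \<in> pseudohyperbolic_disc (z k) r" "u \<in> pseudohyperbolic_disc a R"
        unfolding J_def by blast
      have le: "2 / (1 - r) * (1 - cmod (z k)) \<le> 2 / (1 - r) * (L * d)"
        using dist_J[OF k] r by (intro mult_left_mono) auto
      have "dist (z k) x < 2 / (1 - r) * (1 - cmod (z k))" "dist (z k) u < 2 / (1 - r) * (1 - cmod (z k))"
        using subsetD[OF pseudohyperbolic_disc_subset_ball[OF zd r] x]
          subsetD[OF pseudohyperbolic_disc_subset_ball[OF zd r] u(1)] by (simp_all only: mem_ball)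
      moreover have "dist a u < 2 / (1 - R) * d"
        using subsetD[OF pseudohyperbolic_disc_subset_ball[OF a(2) R] u(2)] by (simp only: mem_ball d_def)
      moreover have "dist a x \<le> dist a u + dist (z k) u + dist (z k) x"
        using dist_triangle[of a x u] dist_triangle[of u x "z k"] by (simp add: dist_commute)
      ultimately have "dist a x < 2 / (1 - R) * d + 2 / (1 - r) * (L * d) + 2 / (1 - r) * (L * d)"
        using le by linarith
      also have "\<dots> = B * d" unfolding B_def by (simp only: distrib_right mult.assoc mult_2)
      finally show "x \<in> ball a (B * d)" by simp
    qed
    have overlap: "(\<Sum>k. indicator (A k) x) \<le> of_nat M * (indicator (\<Union>k. A k) x :: ennreal)"
      if "x \<in> unit_disc" for x
    proof -
      let ?K = "{k. x \<in> pseudohyperbolic_disc (z k) ((1 + r) / 2)}"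
      have sub: "k \<in> ?K" if "x \<in> A k" for k
        using that pseudohyperbolic_disc_mono[of r "(1 + r) / 2" "z k"] r
        by (auto simp: A_def split: if_splits)
      note fK = bspec[OF mult that, THEN conjunct1] and cK = bspec[OF mult that, THEN conjunct2]
      show ?thesis
      proof (cases "x \<in> (\<Union>k. A k)")
        case True
        have "(\<Sum>k. indicator (A k) x :: ennreal) = (\<Sum>k\<in>?K. indicator (A k) x)"
          using fK sub by (intro suminf_finite) (auto simp: indicator_def)
        also have "\<dots> \<le> (\<Sum>k\<in>?K. 1)" by (intro sum_mono) (auto simp: indicator_def)
        also have "\<dots> \<le> of_nat M" using cK by (simp add: of_nat_mono)
        finally show ?thesis using True by simp
      next
        case False
        then have "(\<lambda>k. indicator (A k) x :: ennreal) = (\<lambda>_. 0)" by (auto simp: indicator_def)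
        then show ?thesis by simp
      qed
    qed
    have U: "(\<Union>k. A k) \<in> sets dA" using A by (intro sets.countable_UN) auto
    have Ubd: "emeasure dA (\<Union>k. A k) \<le> ennreal ((B * d)\<^sup>2)"
    proof (rule emeasure_dA_le_ball)
      show "(\<Union>k. A k) \<in> sets borel" "(\<Union>k. A k) \<subseteq> unit_disc" using U by (simp_all only: sets_dA_iff)
      show "(\<Union>k. A k) \<subseteq> ball a (B * d)" using Asub by (rule UN_least)
      show "0 \<le> B * d" using B d by simp
    qed
    have "(\<Sum>k. emeasure dA (A k)) = (\<integral>\<^sup>+x. (\<Sum>k. indicator (A k) x) \<partial>dA)"
      using A by (subst nn_integral_suminf) auto
    also have "\<dots> \<le> (\<integral>\<^sup>+x. of_nat M * indicator (\<Union>k. A k) x \<partial>dA)"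
      using overlap by (intro nn_integral_mono) simp
    also have "\<dots> = of_nat M * emeasure dA (\<Union>k. A k)"
      using U by (intro nn_integral_cmult_indicator)
    also have "\<dots> \<le> of_nat M * ennreal ((B * d)\<^sup>2)"
      using Ubd by (rule mult_left_mono) simp
    finally have area_sum: "(\<Sum>k. emeasure dA (A k)) \<le> of_nat M * ennreal ((B * d)\<^sup>2)" .
    have "pseudohyperbolic_disc a R \<subseteq> (\<Union>k. A k)"
    proof
      fix x assume x: "x \<in> pseudohyperbolic_disc a R"
      then have "x \<in> (\<Union>k. pseudohyperbolic_disc (z k) r)"
        using cover pseudohyperbolic_disc_subset[of a R] by (meson subsetD)
      then obtain k where k: "x \<in> pseudohyperbolic_disc (z k) r" by (rule UN_E)
      then have "k \<in> J" using x unfolding J_def by blast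
      then show "x \<in> (\<Union>k. A k)" using k by (intro UN_I[of k]) (simp_all add: A_def)
    qed
    then have "emeasure \<mu> (pseudohyperbolic_disc a R) \<le> emeasure \<mu> (\<Union>k. A k)"
      using U mu by (intro emeasure_mono) auto
    also have "\<dots> \<le> (\<Sum>k. emeasure \<mu> (A k))"
      using A mu by (intro emeasure_subadditive_countably) auto
    also have "\<dots> \<le> (\<Sum>k. ennreal (\<epsilon>' / r\<^sup>2) * emeasure dA (A k))"
    proof (intro suminf_le summableI)
      fix k
      show "emeasure \<mu> (A k) \<le> ennreal (\<epsilon>' / r\<^sup>2) * emeasure dA (A k)"
      proof (cases "k \<in> J")
        case True
        have "emeasure \<mu> (A k) \<le> ennreal (\<epsilon>' * (1 - cmod (z k))\<^sup>2)"
          using N JN[OF True] True by (simp add: A_def)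
        also have "\<dots> = ennreal (\<epsilon>' / r\<^sup>2) * ennreal ((r * (1 - cmod (z k)))\<^sup>2)"
          using \<epsilon>' r by (simp add: power_mult_distrib flip: ennreal_mult)
        also have "\<dots> \<le> ennreal (\<epsilon>' / r\<^sup>2) * emeasure dA (A k)"
          using True emeasure_dA_pseudohyperbolic_disc_ge[OF zd r]
          by (intro mult_left_mono) (auto simp: A_def)
        finally show ?thesis .
      qed (simp add: A_def)
    qed
    also have "\<dots> = ennreal (\<epsilon>' / r\<^sup>2) * (\<Sum>k. emeasure dA (A k))" by simp
    also have "\<dots> \<le> ennreal (\<epsilon>' / r\<^sup>2) * (of_nat M * ennreal ((B * d)\<^sup>2))"
      using area_sum by (rule mult_left_mono) simp
    also have "\<dots> = ennreal (\<epsilon>' / r\<^sup>2 * (M * (B * d)\<^sup>2))"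
      unfolding ennreal_of_nat_eq_real_of_nat using \<epsilon>' by (simp flip: ennreal_mult)
    also have "\<epsilon>' / r\<^sup>2 * (M * (B * d)\<^sup>2) = \<epsilon> * (1 - cmod a)\<^sup>2"
      using r M B by (simp add: \<epsilon>'_def power_mult_distrib flip: d_def)
    finally show "emeasure \<mu> (pseudohyperbolic_disc a R) \<le> ennreal (\<epsilon> * (1 - cmod a)\<^sup>2)" 
      by simp
  qed
qed

definition separated :: "real \<Rightarrow> complex set \<Rightarrow> bool" where
  "separated r S \<longleftrightarrow> S \<subseteq> unit_disc \<and> (\<forall>a\<in>S. \<forall>b\<in>S. a \<noteq> b \<longrightarrow> b \<notin> pseudohyperbolic_disc a r)"

text \<open>Any point outside the union of the discs could be added to a maximal separated set.\<close>

lemma exists_maximal_separated: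
  assumes "0 < r"
  obtains S where "separated r S" "unit_disc \<subseteq> (\<Union>a\<in>S. pseudohyperbolic_disc a r)"
proof -
  have "\<exists>S\<in>Collect (separated r). \<forall>X\<in>Collect (separated r). S \<subseteq> X \<longrightarrow> X = S"
  proof (rule subset_Zorn_nonempty)
    show "Collect (separated r) \<noteq> {}" by (auto simp: separated_def intro: exI[of _ "{}"])
    fix \<C> assume C: "\<C> \<noteq> {}" "subset.chain (Collect (separated r)) \<C>"
    have sep: "separated r X" if "X \<in> \<C>" for X using C that unfolding subset.chain_def by blast
    have lin: "X \<subseteq> Y \<or> Y \<subseteq> X" if "X \<in> \<C>" "Y \<in> \<C>" for X Y
      using C that unfolding subset.chain_def by blast
    show "\<Union>\<C> \<in> Collect (separated r)"
      unfolding mem_Collect_eq separated_def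
    proof (intro conjI ballI impI)
      show "\<Union>\<C> \<subseteq> unit_disc" using sep unfolding separated_def by blast
      fix a b assume "a \<in> \<Union>\<C>" "b \<in> \<Union>\<C>" and ab: "a \<noteq> b"
      then obtain X where "X \<in> \<C>" "a \<in> X" "b \<in> X" using lin by blast
      then show "b \<notin> pseudohyperbolic_disc a r" using sep ab unfolding separated_def by blast
    qed
  qed
  then obtain S where S: "separated r S" and mx: "\<And>X. separated r X \<Longrightarrow> S \<subseteq> X \<Longrightarrow> X = S" by blast
  have "w \<in> (\<Union>a\<in>S. pseudohyperbolic_disc a r)" if w: "w \<in> unit_disc" for w
  proof (rule ccontr)
    assume nw: "w \<notin> (\<Union>a\<in>S. pseudohyperbolic_disc a r)"
    have "a \<notin> pseudohyperbolic_disc w r" if "a \<in> S" for a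
      using nw that w S pseudohyperbolic_disc_commute[of w a r] by (auto simp: separated_def)
    then have "separated r (insert w S)" using S w nw unfolding separated_def by auto
    then have "w \<in> S" using mx[of "insert w S"] by blast
    moreover have "w \<in> pseudohyperbolic_disc w r"
    proof -
      have "1 - cnj w * w \<noteq> 0" using w by (intro one_minus_cnj_mult_nonzero) auto
      then show ?thesis using w assms by (simp add: mem_pseudohyperbolic_disc)
    qed
    ultimately show False using nw by blast
  qed
  then show ?thesis using that S by blast
qed

text \<open>A packing argument: the Euclidean balls of radius \<open>(r/2) (1 - |a|)\<close> around separated points are
disjoint. When \<open>w\<close> lies in all the discs, these balls have area at least a multiple of
\<open>(1 - |w|)\<^sup>2\<close> and lie in one ball around \<open>w\<close> of area at most a multiple of the same quantity.\<close>

lemma separated_overlap_bound: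
  assumes r: "0 < r" "r < 1" and R: "0 < R" "R < 1"
  shows "\<exists>M::nat. \<forall>S w. separated r S \<longrightarrow> w \<in> unit_disc \<longrightarrow>
    finite {a\<in>S. w \<in> pseudohyperbolic_disc a R} \<and> card {a\<in>S. w \<in> pseudohyperbolic_disc a R} \<le> M"
proof -
  define L where "L = 2 / (1 - R)"
  have L: "0 < L" using R by (simp add: L_def)
  define c where "c = r / 2"
  have c: "0 < c" "c \<le> 1" using r by (auto simp: c_def)
  define M where "M = nat \<lceil>(((1 + L) * L) * L / c)\<^sup>2\<rceil>"
  have "card F \<le> M" if S: "separated r S" and w: "w \<in> unit_disc"
    and F: "finite F" "F \<subseteq> {a\<in>S. w \<in> pseudohyperbolic_disc a R}" for S w F
  proof -
    define d where "d = 1 - cmod w"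
    have d: "0 < d" using w by (simp add: d_def)
    define b where "b a = ball a (c * (1 - cmod a))" for a :: complex
    have Fd: "cmod a < 1" if "a \<in> F" for a using F S that unfolding separated_def by auto
    have da: "1 - cmod a \<le> L * d" "d \<le> L * (1 - cmod a)" if "a \<in> F" for a
      using pseudohyperbolic_disc_boundary_dist[OF Fd[OF that] R, of w] F that
      unfolding L_def d_def by auto
    have bsub: "b a \<subseteq> unit_disc" if "a \<in> F" for a
      unfolding b_def using ball_subset_unit_disc[OF Fd[OF that]] c by blast
    \<comment> \<open>If two balls meet, the distance of their centres is below \<open>r\<close> times the larger boundary distance,
      and \<open>norm_one_minus_ge\<close> turns this into pseudohyperbolic distance below \<open>r\<close>.\<close>
    have aux: False if "a \<in> F" "a' \<in> F" "a \<noteq> a'" "x \<in> b a" "x \<in> b a'" "cmod a \<le> cmod a'" for a a' x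
    proof -
      have "dist a a' \<le> dist a x + dist a' x" by (rule dist_triangle2)
      also have "\<dots> < c * (1 - cmod a) + c * (1 - cmod a')"
        using that by (intro add_strict_mono) (auto simp: b_def)
      also have "\<dots> \<le> c * (1 - cmod a) + c * (1 - cmod a)"
        using that c by (intro add_left_mono mult_left_mono) auto
      also have "\<dots> = r * (1 - cmod a)" by (simp add: c_def)
      also have "\<dots> \<le> r * cmod (1 - cnj a * a')"
        using norm_one_minus_ge[of a a'] Fd that r by (intro mult_left_mono) auto
      finally have "a' \<in> pseudohyperbolic_disc a r"
        using Fd that by (simp add: mem_pseudohyperbolic_disc dist_norm)
      then show False using S F that unfolding separated_def by blast
    qed
    have disj: "disjoint_family_on b F"
      unfolding disjoint_family_on_def
    proof (intro ballI impI)
      fix a a' assume "a \<in> F" "a' \<in> F" "a \<noteq> a'"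
      then show "b a \<inter> b a' = {}" using aux[of a a'] aux[of a' a] linear[of "cmod a" "cmod a'"] by blast
    qed
    have inball: "(\<Union>a\<in>F. b a) \<subseteq> ball w ((1 + L) * L * d)"
    proof
      fix x assume "x \<in> (\<Union>a\<in>F. b a)"
      then obtain a where a: "a \<in> F" "x \<in> b a" by blast
      have "dist a w < L * (1 - cmod a)"
        using pseudohyperbolic_disc_subset_ball[OF Fd[OF a(1)] R] F a(1) unfolding L_def by auto
      moreover have "dist a x < c * (1 - cmod a)" using a by (simp add: b_def)
      moreover have "c * (1 - cmod a) \<le> 1 * (1 - cmod a)" using c Fd[OF a(1)] by (intro mult_right_mono) auto
      moreover have "dist w x \<le> dist a w + dist a x" by (rule dist_triangle3)
      ultimately have "dist w x < (1 + L) * (1 - cmod a)" by (simp add: algebra_simps)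
      also have "\<dots> \<le> (1 + L) * (L * d)" using da[OF a(1)] L by (intro mult_left_mono) auto
      finally show "x \<in> ball w ((1 + L) * L * d)" by (simp add: mult.assoc)
    qed
    have "ennreal (card F * (c * d / L)\<^sup>2) = (\<Sum>a\<in>F. ennreal ((c * d / L)\<^sup>2))"
      by (simp add: ennreal_mult' ennreal_of_nat_eq_real_of_nat)
    also have "\<dots> \<le> (\<Sum>a\<in>F. emeasure dA (b a))"
    proof (rule sum_mono)
      fix a assume a: "a \<in> F"
      have "d / L \<le> 1 - cmod a" using da(2)[OF a] L by (simp add: pos_divide_le_eq mult.commute)
      then have "c * d / L \<le> c * (1 - cmod a)"
        unfolding times_divide_eq_right[symmetric] using c by (intro mult_left_mono) auto
      then have "(c * d / L)\<^sup>2 \<le> (c * (1 - cmod a))\<^sup>2" using c d L by (intro power_mono) auto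
      then show "ennreal ((c * d / L)\<^sup>2) \<le> emeasure dA (b a)"
        using bsub[OF a] Fd[OF a] c unfolding b_def by (subst emeasure_dA_ball) (auto intro: ennreal_leI)
    qed
    also have "\<dots> = emeasure dA (\<Union>a\<in>F. b a)"
    proof (rule sum_emeasure[OF _ disj F(1)])
      show "b ` F \<subseteq> sets dA" using bsub by (auto simp: sets_dA_iff b_def)
    qed
    also have "\<dots> \<le> ennreal (((1 + L) * L * d)\<^sup>2)"
    proof (rule emeasure_dA_le_ball[OF _ _ inball])
      show "(\<Union>a\<in>F. b a) \<in> sets borel" by (intro borel_open open_UN ballI) (simp add: b_def)
      show "(\<Union>a\<in>F. b a) \<subseteq> unit_disc" using bsub by (rule UN_least)
      show "0 \<le> (1 + L) * L * d" using L d by simp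
    qed
    finally have "card F * (c * d / L)\<^sup>2 \<le> ((1 + L) * L * d)\<^sup>2" by simp
    then have "card F * (c / L)\<^sup>2 * d\<^sup>2 \<le> ((1 + L) * L)\<^sup>2 * d\<^sup>2"
      by (simp add: power_mult_distrib power_divide mult_ac)
    then have "card F * (c / L)\<^sup>2 \<le> ((1 + L) * L)\<^sup>2" using d by simp
    then have "card F \<le> ((1 + L) * L)\<^sup>2 / (c / L)\<^sup>2" using c L by (simp add: pos_le_divide_eq)
    also have "\<dots> = (((1 + L) * L) * L / c)\<^sup>2" by (simp add: power_divide power_mult_distrib)
    finally show "card F \<le> M" unfolding M_def by linarith
  qed
  then show ?thesis
    by (intro exI[of _ M] allI impI finite_if_finite_subsets_card_bdd)
qed

text \<open>A maximal separated set covers by maximality and overlaps boundedly. It must be countably infinite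
so that it can be enumerated without repetition: repetitions would spoil the count of overlaps.\<close>

lemma lattice_seq_exists:
  assumes r: "0 < r" "r < 1"
  shows "\<exists>z. lattice_seq r z"
proof -
  obtain S where S: "separated r S" "unit_disc \<subseteq> (\<Union>a\<in>S. pseudohyperbolic_disc a r)"
    using exists_maximal_separated r by blast
  let ?R = "(1 + r) / 2"
  have R: "0 < ?R" "?R < 1" using r by auto
  obtain M :: nat where "\<forall>S w. separated r S \<longrightarrow> w \<in> unit_disc \<longrightarrow>
    finite {a\<in>S. w \<in> pseudohyperbolic_disc a ?R} \<and> card {a\<in>S. w \<in> pseudohyperbolic_disc a ?R} \<le> M"
    using separated_overlap_bound[OF r R] by (rule exE)
  note M = this[rule_format, OF S(1)]
  have Sd: "cmod a < 1" if "a \<in> S" for a using S that by (auto simp: separated_def)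
  \<comment> \<open>Every disc contains a point of a countable dense set, and each such point lies in finitely many discs.\<close>
  have "countable S"
  proof -
    obtain D :: "complex set" where D: "countable D" "\<And>X. open X \<Longrightarrow> X \<noteq> {} \<Longrightarrow> \<exists>d\<in>D. d \<in> X"
      by (rule countable_dense_setE) blast
    have "S \<subseteq> (\<Union>w\<in>D \<inter> unit_disc. {a\<in>S. w \<in> pseudohyperbolic_disc a ?R})"
    proof
      fix a assume a: "a \<in> S"
      have "a \<in> pseudohyperbolic_disc a ?R"
        using ball_subset_pseudohyperbolic_disc[OF Sd[OF a] R] R Sd[OF a] by auto
      then obtain w where "w \<in> D" "w \<in> pseudohyperbolic_disc a ?R"
        using D(2)[OF open_pseudohyperbolic_disc[OF Sd[OF a]]] by blast
      then show "a \<in> (\<Union>w\<in>D \<inter> unit_disc. {a\<in>S. w \<in> pseudohyperbolic_disc a ?R})"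
        using a pseudohyperbolic_disc_subset by blast
    qed
    moreover have "countable (\<Union>w\<in>D \<inter> unit_disc. {a\<in>S. w \<in> pseudohyperbolic_disc a ?R})"
      using M countable_subset[OF Int_lower1 D(1)] by (intro countable_UN countable_finite[of "Collect _"]) auto
    ultimately show ?thesis by (rule countable_subset)
  qed
  moreover have "infinite S"
  proof
    assume fin: "finite S"
    define q where "q = Min (insert 1 ((\<lambda>a. 1 - cmod a) ` S))"
    have q: "0 < q" "q \<le> 1" "\<And>a. a \<in> S \<Longrightarrow> q \<le> 1 - cmod a"
      using Sd fin unfolding q_def by auto
    \<comment> \<open>A point at boundary distance \<open>x\<close> is too close to the circle for any of finitely many discs.\<close>
    define x where "x = q * (1 - r) / 4"
    have "q * (1 - r) \<le> 1 * 1" using q r by (intro mult_mono) auto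
    then have x: "0 < x" "x < 1" using q r by (auto simp: x_def)
    define w where "w = complex_of_real (1 - x)"
    have w: "cmod w = 1 - x" unfolding w_def norm_of_real using x by simp
    then have "w \<in> unit_disc" using x by simp
    then obtain a where a: "a \<in> S" "w \<in> pseudohyperbolic_disc a r" using S(2) by blast
    have "q \<le> 2 / (1 - r) * (1 - cmod w)"
      using pseudohyperbolic_disc_boundary_dist(1)[OF Sd r, OF a] q(3)[OF a(1)] by linarith
    also have "\<dots> = q / 2" using r by (simp add: w x_def)
    finally show False using q by simp
  qed
  ultimately have bij: "bij_betw (from_nat_into S) UNIV S" by (rule bij_betw_from_nat_into)
  define z where "z = from_nat_into S"
  have z: "inj z" "range z = S" using bij unfolding z_def bij_betw_def by auto
  have "lattice_seq r z"
    unfolding lattice_seq_def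
  proof (intro conjI exI[of _ "Suc M"] ballI)
    show "range z \<subseteq> unit_disc" using z S by (simp add: separated_def)
    show "unit_disc \<subseteq> (\<Union>k. pseudohyperbolic_disc (z k) r)" using S(2) z(2) by blast
    fix w assume w: "w \<in> unit_disc"
    have eq: "{k. w \<in> pseudohyperbolic_disc (z k) ?R} = z -` {a\<in>S. w \<in> pseudohyperbolic_disc a ?R}"
      using z(2) by auto
    show "finite {k. w \<in> pseudohyperbolic_disc (z k) ?R}"
      unfolding eq using M[OF w] z(1) by (intro finite_vimageI) auto
    show "card {k. w \<in> pseudohyperbolic_disc (z k) ?R} \<le> Suc M"
      unfolding eq using M[OF w] z(2) by (subst card_vimage_inj[OF z(1)]) auto
  qed simp
  then show ?thesis by blast
qed

section \<open>The space \<open>L\<^sup>p\<close> for all \<open>p > 0\<close>\<close>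

lemma Lp_space_iff:
  "f \<in> Lp_space p M \<longleftrightarrow> f \<in> borel_measurable M \<and> (\<integral>\<^sup>+x. ennreal (cmod (f x) powr p) \<partial>M) < \<infinity>"
proof (cases "f \<in> borel_measurable M")
  case True
  then have "(\<lambda>x. cmod (f x) powr p) \<in> borel_measurable M" by measurable
  then show ?thesis using True by (simp add: Lp_space_def integrable_iff_bounded)
qed (simp add: Lp_space_def)

lemma Lp_norm_nonneg: "0 \<le> Lp_norm p M f"
  by (simp add: Lp_norm_def)

lemma Lp_norm_powr:
  assumes "f \<in> Lp_space p M" "0 < p"
  shows "(\<integral>\<^sup>+x. ennreal (cmod (f x) powr p) \<partial>M) = ennreal (Lp_norm p M f powr p)"
proof -
  have "integrable M (\<lambda>x. cmod (f x) powr p)" using assms by (simp add: Lp_space_def)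
  then have "(\<integral>\<^sup>+x. ennreal (cmod (f x) powr p) \<partial>M) = ennreal (\<integral>x. cmod (f x) powr p \<partial>M)"
    by (rule nn_integral_eq_integral) simp
  also have "0 \<le> (\<integral>x. cmod (f x) powr p \<partial>M)" by (rule integral_nonneg_AE) simp
  then have "(\<integral>x. cmod (f x) powr p \<partial>M) = Lp_norm p M f powr p"
    using assms(2) by (simp add: Lp_norm_def powr_powr)
  finally show ?thesis .
qed

lemma Lp_norm_tendsto_zero_iff:
  assumes "\<And>k. f k \<in> Lp_space p M" "0 < p"
  shows "(\<lambda>k. Lp_norm p M (f k)) \<longlonglongrightarrow> 0 \<longleftrightarrow> (\<lambda>k. \<integral>\<^sup>+x. ennreal (cmod (f k x) powr p) \<partial>M) \<longlonglongrightarrow> 0"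
proof -
  have eq: "(\<lambda>k. \<integral>\<^sup>+x. ennreal (cmod (f k x) powr p) \<partial>M) = (\<lambda>k. ennreal (Lp_norm p M (f k) powr p))"
    using Lp_norm_powr[OF assms(1,2)] by simp
  have "(\<lambda>k. Lp_norm p M (f k)) \<longlonglongrightarrow> 0 \<longleftrightarrow> (\<lambda>k. Lp_norm p M (f k) powr p) \<longlonglongrightarrow> 0"
  proof
    assume "(\<lambda>k. Lp_norm p M (f k)) \<longlonglongrightarrow> 0"
    then show "(\<lambda>k. Lp_norm p M (f k) powr p) \<longlonglongrightarrow> 0"
      using assms(2) by (intro tendsto_zero_powrI[where b = p]) (auto simp: Lp_norm_nonneg)
  next
    assume "(\<lambda>k. Lp_norm p M (f k) powr p) \<longlonglongrightarrow> 0"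
    from tendsto_zero_powrI[OF this tendsto_const[of "1 / p"]]
    have "(\<lambda>k. (Lp_norm p M (f k) powr p) powr (1 / p)) \<longlonglongrightarrow> 0" using assms(2) by simp
    then show "(\<lambda>k. Lp_norm p M (f k)) \<longlonglongrightarrow> 0"
      using assms(2) by (simp add: powr_powr Lp_norm_nonneg)
  qed
  then show ?thesis unfolding eq by (simp add: ennreal_tendsto_0_iff)
qed

text \<open>The constant \<open>2 powr p\<close> works for all \<open>p > 0\<close>; Minkowski's inequality would require \<open>p \<ge> 1\<close>.\<close>

lemma powr_norm_diff_le:
  fixes a b :: complex
  assumes "0 < p"
  shows "cmod (a - b) powr p \<le> 2 powr p * (cmod a powr p + cmod b powr p)"
proof -
  define m where "m = max (cmod a) (cmod b)"
  have "cmod (a - b) \<le> 2 * m" using norm_triangle_ineq4[of a b] by (simp add: m_def)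
  then have "cmod (a - b) powr p \<le> (2 * m) powr p" using assms by (intro powr_mono2) auto
  also have "\<dots> = 2 powr p * m powr p" by (simp add: powr_mult)
  also have "\<dots> \<le> 2 powr p * (cmod a powr p + cmod b powr p)"
    by (intro mult_left_mono) (auto simp: m_def max_def)
  finally show ?thesis .
qed

lemma nn_integral_powr_norm_diff_le:
  fixes f g :: "'a \<Rightarrow> complex"
  assumes p: "0 < p" and [measurable]: "f \<in> borel_measurable M" "g \<in> borel_measurable M"
  shows "(\<integral>\<^sup>+x. ennreal (cmod (f x - g x) powr p) \<partial>M) \<le>
    ennreal (2 powr p) * ((\<integral>\<^sup>+x. ennreal (cmod (f x) powr p) \<partial>M) + (\<integral>\<^sup>+x. ennreal (cmod (g x) powr p) \<partial>M))"
proof -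
  have "(\<integral>\<^sup>+x. ennreal (cmod (f x - g x) powr p) \<partial>M) \<le>
      (\<integral>\<^sup>+x. ennreal (2 powr p) * (ennreal (cmod (f x) powr p) + ennreal (cmod (g x) powr p)) \<partial>M)"
    using powr_norm_diff_le[OF p]
    by (intro nn_integral_mono) (simp add: ennreal_leI flip: ennreal_plus ennreal_mult)
  also have "\<dots> = ennreal (2 powr p) *
      ((\<integral>\<^sup>+x. ennreal (cmod (f x) powr p) \<partial>M) + (\<integral>\<^sup>+x. ennreal (cmod (g x) powr p) \<partial>M))"
    by (simp add: nn_integral_cmult nn_integral_add)
  finally show ?thesis .
qed

lemma Lp_space_diff:
  assumes "0 < p" "f \<in> Lp_space p M" "g \<in> Lp_space p M"
  shows "(\<lambda>x. f x - g x) \<in> Lp_space p M"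
  unfolding Lp_space_iff
proof
  have fg: "f \<in> borel_measurable M" "g \<in> borel_measurable M"
    and fin: "(\<integral>\<^sup>+x. ennreal (cmod (f x) powr p) \<partial>M) < \<infinity>" "(\<integral>\<^sup>+x. ennreal (cmod (g x) powr p) \<partial>M) < \<infinity>"
    using assms unfolding Lp_space_iff by auto
  show "(\<lambda>x. f x - g x) \<in> borel_measurable M" using fg by measurable
  show "(\<integral>\<^sup>+x. ennreal (cmod (f x - g x) powr p) \<partial>M) < \<infinity>"
    using fin by (intro order_le_less_trans[OF nn_integral_powr_norm_diff_le[OF assms(1) fg]])
      (simp add: ennreal_mult_less_top)
qed

section \<open>Weights between positive constants\<close>

lemma admissible_weight_bounds:
  assumes "admissible_weight \<sigma>"
  obtains m S where "0 < m" "\<forall>x\<in>{0..1}. m \<le> \<sigma> x \<and> \<sigma> x \<le> S" "continuous_on {0..1} \<sigma>"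
proof -
  have w: "weight \<sigma>" using assms unfolding admissible_weight_def by (rule conjunct1)
  then have pos: "\<forall>x\<in>{0..1}. 0 < \<sigma> x" unfolding weight_def by (rule conjunct1)
  have "C2_unit_interval \<sigma>" using w unfolding weight_def by blast
  then obtain \<sigma>' where "\<forall>x\<in>{0..1}. (\<sigma> has_real_derivative \<sigma>' x) (at x within {0..1})"
    unfolding C2_unit_interval_def by blast
  then have cont: "continuous_on {0..1} \<sigma>" by (intro DERIV_continuous_on) auto
  obtain x where x: "x \<in> {0..1}" "\<forall>y\<in>{0..1}. \<sigma> x \<le> \<sigma> y"
    using continuous_attains_inf[OF _ _ cont] by auto
  obtain y where y: "y \<in> {0..1}" "\<forall>z\<in>{0..1}. \<sigma> z \<le> \<sigma> y"
    using continuous_attains_sup[OF _ _ cont] by auto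
  show ?thesis by (rule that[of "\<sigma> x" "\<sigma> y"]) (use pos x y cont in auto)
qed

locale comparable_weight =
  fixes \<sigma> :: "real \<Rightarrow> real" and m S :: real
  assumes m_pos: "0 < m"
    and bounds: "\<forall>x\<in>{0..1}. m \<le> \<sigma> x \<and> \<sigma> x \<le> S"
    and cont: "continuous_on {0..1} \<sigma>"
begin

lemma S_pos: "0 < S"
  using m_pos bspec[OF bounds, of 0] by simp

lemma weight_measurable [measurable]: "(\<lambda>z. \<sigma> (cmod z)) \<in> borel_measurable dA"
  by (intro measurable_dA_continuous continuous_on_compose2[OF cont] continuous_intros) auto

lemma sets_Omega: "sets (Omega \<sigma>) = sets dA"
  by (simp add: Omega_def)

lemma space_Omega [simp]: "space (Omega \<sigma>) = unit_disc"
  by (simp add: Omega_def)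

lemma measurable_Omega: "borel_measurable (Omega \<sigma>) = borel_measurable dA"
  by (rule measurable_cong_sets) (simp_all add: sets_Omega)

lemma nn_integral_Omega_le:
  assumes "g \<in> borel_measurable dA"
  shows "(\<integral>\<^sup>+z. g z \<partial>Omega \<sigma>) \<le> ennreal S * (\<integral>\<^sup>+z. g z \<partial>dA)"
proof -
  have "(\<integral>\<^sup>+z. g z \<partial>Omega \<sigma>) = (\<integral>\<^sup>+z. ennreal (\<sigma> (cmod z)) * g z \<partial>dA)"
    unfolding Omega_def using assms by (intro nn_integral_density) measurable
  also have "\<dots> \<le> (\<integral>\<^sup>+z. ennreal S * g z \<partial>dA)"
    using bounds by (intro nn_integral_mono mult_right_mono ennreal_leI) auto
  also have "\<dots> = ennreal S * (\<integral>\<^sup>+z. g z \<partial>dA)" using assms by (rule nn_integral_cmult)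
  finally show ?thesis .
qed

lemma nn_integral_dA_le:
  assumes "g \<in> borel_measurable dA"
  shows "(\<integral>\<^sup>+z. g z \<partial>dA) \<le> ennreal (1 / m) * (\<integral>\<^sup>+z. g z \<partial>Omega \<sigma>)"
proof -
  have "(\<integral>\<^sup>+z. g z \<partial>dA) = (\<integral>\<^sup>+z. ennreal (1 / m) * (ennreal m * g z) \<partial>dA)"
    using m_pos by (simp flip: mult.assoc ennreal_mult)
  also have "\<dots> \<le> (\<integral>\<^sup>+z. ennreal (1 / m) * (ennreal (\<sigma> (cmod z)) * g z) \<partial>dA)"
    using bounds by (intro nn_integral_mono mult_left_mono mult_right_mono ennreal_leI) auto
  also have "\<dots> = ennreal (1 / m) * (\<integral>\<^sup>+z. ennreal (\<sigma> (cmod z)) * g z \<partial>dA)"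
    using assms by (intro nn_integral_cmult) measurable
  also have "(\<integral>\<^sup>+z. ennreal (\<sigma> (cmod z)) * g z \<partial>dA) = (\<integral>\<^sup>+z. g z \<partial>Omega \<sigma>)"
    unfolding Omega_def using assms by (intro nn_integral_density[symmetric]) measurable
  finally show ?thesis .
qed

end

lemma holomorphic_measurable_dA: "f holomorphic_on unit_disc \<Longrightarrow> f \<in> borel_measurable dA"
  by (intro measurable_dA_continuous holomorphic_on_imp_continuous_on)

lemma holomorphic_ennreal_powr_measurable:
  assumes "f holomorphic_on unit_disc"
  shows "(\<lambda>z. ennreal (cmod (f z) powr p)) \<in> borel_measurable dA"
  using holomorphic_powr_measurable[OF assms] by (rule measurable_compose) simp

lemma iterated_weight_Suc: "iterated_weight \<psi> \<phi> (Suc n) z = \<psi> z * iterated_weight \<psi> \<phi> n (\<phi> z)"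
  unfolding iterated_weight_def prod.lessThan_Suc_shift by (simp add: funpow_swap1)

lemma weighted_comp_funpow:
  "(weighted_comp \<psi> \<phi> ^^ n) f z = iterated_weight \<psi> \<phi> n z * f ((\<phi> ^^ n) z)"
proof (induction n arbitrary: z)
  case 0
  then show ?case by (simp add: iterated_weight_def)
next
  case (Suc n)
  have "(weighted_comp \<psi> \<phi> ^^ Suc n) f z = \<psi> z * (weighted_comp \<psi> \<phi> ^^ n) f (\<phi> z)"
    by (simp add: weighted_comp_def)
  also have "\<dots> = iterated_weight \<psi> \<phi> (Suc n) z * f ((\<phi> ^^ n) (\<phi> z))"
    by (simp add: Suc iterated_weight_Suc)
  finally show ?case by (simp add: funpow_swap1)
qed

text \<open>If \<open>G\<^sub>k\<close> tends to \<open>0\<close> pointwise and to \<open>g\<close> in \<open>L\<^sup>p\<close>, then Fatou's lemma, applied to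
\<open>|G\<^sub>k - g|\<^sup>p\<close>, gives \<open>g = 0\<close> almost everywhere.\<close>

lemma nn_integral_powr_tendsto_zero_limit:
  fixes G :: "nat \<Rightarrow> 'a \<Rightarrow> complex"
  assumes p: "0 < p" and [measurable]: "\<And>k. G k \<in> borel_measurable M" "g \<in> borel_measurable M"
    and lim: "(\<lambda>k. \<integral>\<^sup>+x. ennreal (cmod (G k x - g x) powr p) \<partial>M) \<longlonglongrightarrow> 0"
    and pt: "\<And>x. x \<in> space M \<Longrightarrow> (\<lambda>k. G k x) \<longlonglongrightarrow> 0"
  shows "(\<lambda>k. \<integral>\<^sup>+x. ennreal (cmod (G k x) powr p) \<partial>M) \<longlonglongrightarrow> 0"
proof -
  have "(\<integral>\<^sup>+x. ennreal (cmod (g x) powr p) \<partial>M)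
      = (\<integral>\<^sup>+x. liminf (\<lambda>k. ennreal (cmod (G k x - g x) powr p)) \<partial>M)"
  proof (rule nn_integral_cong)
    fix x assume "x \<in> space M"
    then have "(\<lambda>k. cmod (G k x - g x)) \<longlonglongrightarrow> cmod (0 - g x)" by (intro tendsto_intros pt)
    then have "(\<lambda>k. cmod (G k x - g x) powr p) \<longlonglongrightarrow> cmod (g x) powr p"
      using p by (intro tendsto_powr') auto
    then have "(\<lambda>k. ennreal (cmod (G k x - g x) powr p)) \<longlonglongrightarrow> ennreal (cmod (g x) powr p)"
      by (rule tendsto_ennrealI)
    then show "ennreal (cmod (g x) powr p) = liminf (\<lambda>k. ennreal (cmod (G k x - g x) powr p))"
      by (intro lim_imp_Liminf[symmetric]) auto
  qed
  also have "\<dots> \<le> liminf (\<lambda>k. \<integral>\<^sup>+x. ennreal (cmod (G k x - g x) powr p) \<partial>M)"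
    by (rule nn_integral_liminf) measurable
  also have "\<dots> = 0" using lim by (intro lim_imp_Liminf) auto
  finally have "(\<integral>\<^sup>+x. ennreal (cmod (g x) powr p) \<partial>M) = 0" by simp
  then have "AE x in M. ennreal (cmod (g x) powr p) = 0"
    by (subst (asm) nn_integral_0_iff_AE) auto
  then have g0: "AE x in M. g x = 0"
    by eventually_elim (use p in \<open>auto simp: ennreal_eq_0_iff\<close>)
  have "(\<integral>\<^sup>+x. ennreal (cmod (G k x) powr p) \<partial>M) = (\<integral>\<^sup>+x. ennreal (cmod (G k x - g x) powr p) \<partial>M)" for k
    using g0 by (intro nn_integral_cong_AE) auto
  then show ?thesis using lim by simp
qed

section \<open>Test functions\<close>

text \<open>The holomorphic function with \<open>|f|\<^sup>p\<close> equal to the Berezin density at \<open>a\<close>.\<close>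

definition test_function :: "real \<Rightarrow> real \<Rightarrow> complex \<Rightarrow> complex \<Rightarrow> complex" where
  "test_function s p a z =
     complex_of_real ((1 - cmod a) powr ((s - 2) / p)) * (1 - cnj a * z) powr (- complex_of_real (s / p))"

lemma test_function_holomorphic:
  assumes a: "cmod a < 1"
  shows "test_function s p a holomorphic_on unit_disc"
proof -
  have "1 - cnj a * z \<notin> \<real>\<^sub>\<le>\<^sub>0" if "z \<in> unit_disc" for z
  proof -
    have "cmod (cnj a * z) \<le> cmod a * 1"
      unfolding norm_mult complex_mod_cnj using a that by (intro mult_left_mono) auto
    then have "Re (cnj a * z) < 1" using complex_Re_le_cmod[of "cnj a * z"] a by linarith
    then show ?thesis by (simp add: complex_nonpos_Reals_iff)
  qed
  then show ?thesis unfolding test_function_def by (intro holomorphic_intros) auto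
qed

lemma norm_test_function:
  "cmod (test_function s p a z) =
    (1 - cmod a) powr ((s - 2) / p) * cmod (1 - cnj a * z) powr (- (s / p))"
  unfolding test_function_def norm_mult by (subst norm_powr_real_powr') auto

lemma norm_test_function_powr:
  assumes "0 < p"
  shows "cmod (test_function s p a z) powr p = berezin_density s a z"
proof -
  have "(s - 2) / p * p = s - 2" "- (s / p) * p = - s" using assms by auto
  then show ?thesis
    unfolding norm_test_function berezin_density_def powr_mult powr_powr
    by (simp only: powr_minus divide_inverse)
qed

lemma test_function_tendsto_zero:
  assumes a: "\<And>k. cmod (a k) < 1" and lim: "(\<lambda>k. 1 - cmod (a k)) \<longlonglongrightarrow> 0"
    and s: "2 < s" and p: "0 < p" and z: "cmod z < 1"
  shows "(\<lambda>k. test_function s p (a k) z) \<longlonglongrightarrow> 0"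
proof (rule Lim_null_comparison)
  show "\<forall>\<^sub>F k in sequentially. cmod (test_function s p (a k) z)
      \<le> (1 - cmod (a k)) powr ((s - 2) / p) * (1 - cmod z) powr (- (s / p))"
  proof (rule always_eventually, rule allI)
    fix k
    have "1 - cmod z \<le> cmod (1 - cnj (a k) * z)"
      using norm_one_minus_ge[OF z a[of k]] by (simp add: norm_one_minus_cnj_commute[of z])
    then have "cmod (1 - cnj (a k) * z) powr (- (s / p)) \<le> (1 - cmod z) powr (- (s / p))"
      using s p z by (intro powr_mono2') auto
    then show "cmod (test_function s p (a k) z)
      \<le> (1 - cmod (a k)) powr ((s - 2) / p) * (1 - cmod z) powr (- (s / p))"
      unfolding norm_test_function by (rule mult_left_mono) simp
  qed
  have "(\<lambda>k. (1 - cmod (a k)) powr ((s - 2) / p)) \<longlonglongrightarrow> 0"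
    using s p a by (intro tendsto_zero_powrI[OF lim tendsto_const]) (auto simp: less_imp_le)
  then show "(\<lambda>k. (1 - cmod (a k)) powr ((s - 2) / p) * (1 - cmod z) powr (- (s / p))) \<longlonglongrightarrow> 0"
    by (rule tendsto_mult_left_zero)
qed

section \<open>Powers of the weighted composition operator\<close>

locale weighted_composition = comparable_weight +
  fixes p :: real and \<psi> \<phi> :: "complex \<Rightarrow> complex"
  assumes p_pos: "0 < p"
    and hol_psi: "\<psi> holomorphic_on unit_disc"
    and hol_phi: "\<phi> holomorphic_on unit_disc" and phi_disc: "\<phi> ` unit_disc \<subseteq> unit_disc"
    and maps_into_Lp: "\<And>f. f \<in> bergman_space p \<sigma> \<Longrightarrow> weighted_comp \<psi> \<phi> f \<in> Lp_space p (Omega \<sigma>)"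
begin

abbreviation "power_op n \<equiv> weighted_comp \<psi> \<phi> ^^ n"
abbreviation "mu n \<equiv> Omega_n p \<sigma> \<psi> \<phi> n"

lemma phi_funpow_disc: "z \<in> unit_disc \<Longrightarrow> (\<phi> ^^ n) z \<in> unit_disc"
  using phi_disc by (induction n) (auto simp: image_subset_iff)

lemma phi_funpow_holomorphic: "(\<phi> ^^ n) holomorphic_on unit_disc"
proof (induction n)
  case 0
  then show ?case by (simp add: id_def holomorphic_on_ident)
next
  case (Suc n)
  have "\<phi> \<circ> (\<phi> ^^ n) holomorphic_on unit_disc"
    using Suc hol_phi phi_funpow_disc by (intro holomorphic_on_compose_gen[of _ _ _ unit_disc]) auto
  then show ?case by (simp only: funpow.simps(2))
qed

lemma iterated_weight_holomorphic: "iterated_weight \<psi> \<phi> n holomorphic_on unit_disc"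
proof -
  have "\<psi> \<circ> (\<phi> ^^ j) holomorphic_on unit_disc" for j
    using phi_funpow_holomorphic hol_psi phi_funpow_disc
    by (intro holomorphic_on_compose_gen[of _ _ _ unit_disc]) auto
  then have "(\<lambda>z. \<Prod>j<n. \<psi> ((\<phi> ^^ j) z)) holomorphic_on unit_disc"
    by (intro holomorphic_intros) (simp add: comp_def)
  then show ?thesis by (simp add: iterated_weight_def[abs_def])
qed

lemma power_op_bergman: "f \<in> bergman_space p \<sigma> \<Longrightarrow> power_op n f \<in> bergman_space p \<sigma>"
proof (induction n)
  case (Suc n)
  then have f: "power_op n f \<in> bergman_space p \<sigma>" by simp
  have "power_op n f \<circ> \<phi> holomorphic_on unit_disc"
    using f hol_phi phi_disc
    by (intro holomorphic_on_compose_gen[of _ _ _ unit_disc]) (auto simp: bergman_space_def)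
  then have "weighted_comp \<psi> \<phi> (power_op n f) holomorphic_on unit_disc"
    unfolding weighted_comp_def by (intro holomorphic_intros hol_psi) (simp add: comp_def)
  then show ?case using maps_into_Lp[OF f] by (simp add: bergman_space_def)
qed simp

lemma bergman_space_iff:
  "f \<in> bergman_space p \<sigma> \<longleftrightarrow>
    f holomorphic_on unit_disc \<and> (\<integral>\<^sup>+z. ennreal (cmod (f z) powr p) \<partial>Omega \<sigma>) < \<infinity>"
  unfolding bergman_space_def Lp_space_iff measurable_Omega
  using holomorphic_measurable_dA by auto

lemma bergman_spaceI:
  assumes "f holomorphic_on unit_disc" "(\<integral>\<^sup>+z. ennreal (cmod (f z) powr p) \<partial>dA) \<le> ennreal B"
  shows "f \<in> bergman_space p \<sigma>"
    and "(\<integral>\<^sup>+z. ennreal (cmod (f z) powr p) \<partial>Omega \<sigma>) \<le> ennreal (S * B)"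
proof -
  have "(\<integral>\<^sup>+z. ennreal (cmod (f z) powr p) \<partial>Omega \<sigma>) \<le> ennreal S * (\<integral>\<^sup>+z. ennreal (cmod (f z) powr p) \<partial>dA)"
    by (intro nn_integral_Omega_le holomorphic_ennreal_powr_measurable assms(1))
  also have "\<dots> \<le> ennreal S * ennreal B" using assms(2) by (rule mult_left_mono) simp
  also have "\<dots> = ennreal (S * B)" using S_pos by (simp add: ennreal_mult')
  finally show *: "(\<integral>\<^sup>+z. ennreal (cmod (f z) powr p) \<partial>Omega \<sigma>) \<le> ennreal (S * B)" .
  then show "f \<in> bergman_space p \<sigma>"
    using assms(1) unfolding bergman_space_iff by (auto intro: order_le_less_trans)
qed

lemma sets_mu: "sets (mu n) = sets dA"
  by (simp add: Omega_n_def sets_Omega)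

lemma nn_integral_mu:
  assumes g: "g \<in> borel_measurable dA"
  shows "(\<integral>\<^sup>+w. g w \<partial>mu n) =
    (\<integral>\<^sup>+z. ennreal (cmod (iterated_weight \<psi> \<phi> n z) powr p) * g ((\<phi> ^^ n) z) \<partial>Omega \<sigma>)"
proof -
  have "(\<phi> ^^ n) \<in> measurable dA (restrict_space borel unit_disc)"
    using holomorphic_measurable_dA[OF phi_funpow_holomorphic] phi_funpow_disc
    by (intro measurable_restrict_space2) auto
  then have phi: "(\<phi> ^^ n) \<in> measurable dA dA"
    using measurable_cong_sets[OF refl sets_dA[symmetric]] by blast
  then have phi': "(\<phi> ^^ n) \<in> measurable (Omega \<sigma>) (Omega \<sigma>)"
    using measurable_cong_sets[OF sets_Omega sets_Omega] by blast
  have w: "(\<lambda>z. ennreal (cmod (iterated_weight \<psi> \<phi> n z) powr p)) \<in> borel_measurable (Omega \<sigma>)"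
    unfolding measurable_Omega
    by (intro holomorphic_ennreal_powr_measurable iterated_weight_holomorphic)
  have gphi: "(\<lambda>z. g ((\<phi> ^^ n) z)) \<in> borel_measurable (Omega \<sigma>)"
    unfolding measurable_Omega using measurable_compose[OF phi g] .
  have "(\<integral>\<^sup>+w. g w \<partial>mu n) = (\<integral>\<^sup>+z. g ((\<phi> ^^ n) z)
      \<partial>density (Omega \<sigma>) (\<lambda>z. ennreal (cmod (iterated_weight \<psi> \<phi> n z) powr p)))"
    unfolding Omega_n_def
  proof (rule nn_integral_distr)
    show "(\<phi> ^^ n) \<in> density (Omega \<sigma>) (\<lambda>z. ennreal (cmod (iterated_weight \<psi> \<phi> n z) powr p)) \<rightarrow>\<^sub>M Omega \<sigma>"
      using phi' by simp
    show "g \<in> borel_measurable (distr (density (Omega \<sigma>)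
        (\<lambda>z. ennreal (cmod (iterated_weight \<psi> \<phi> n z) powr p))) (Omega \<sigma>) (\<phi> ^^ n))"
      using g by (simp add: measurable_Omega)
  qed
  also have "\<dots> = (\<integral>\<^sup>+z. ennreal (cmod (iterated_weight \<psi> \<phi> n z) powr p) * g ((\<phi> ^^ n) z) \<partial>Omega \<sigma>)"
    using w gphi by (rule nn_integral_density)
  finally show ?thesis .
qed

text \<open>This identity turns statements about \<open>C\<^sup>n\<close> into statements about the measure \<open>\<Omega>\<^sub>n\<close>.\<close>

lemma nn_integral_mu_powr:
  assumes "f holomorphic_on unit_disc"
  shows "(\<integral>\<^sup>+w. ennreal (cmod (f w) powr p) \<partial>mu n)
    = (\<integral>\<^sup>+z. ennreal (cmod (power_op n f z) powr p) \<partial>Omega \<sigma>)"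
  unfolding nn_integral_mu[OF holomorphic_ennreal_powr_measurable[OF assms]]
  by (simp add: weighted_comp_funpow norm_mult powr_mult ennreal_mult)

text \<open>The total mass is the integral of \<open>|C\<^sup>n 1|\<^sup>p\<close>, and constants belong to the Bergman space.\<close>

lemma finite_mu: "finite_measure (mu n)"
proof
  have "(\<integral>\<^sup>+z. ennreal (cmod ((\<lambda>_. 1) z) powr p) \<partial>dA) \<le> ennreal 1"
    using emeasure_dA_ball[of 0 1] by simp
  then have "(\<lambda>_. 1) \<in> bergman_space p \<sigma>" by (intro bergman_spaceI(1)[of _ 1]) auto
  then have "power_op n (\<lambda>_. 1) \<in> bergman_space p \<sigma>" by (rule power_op_bergman)
  then have "(\<integral>\<^sup>+w. ennreal (cmod ((\<lambda>_. 1) w) powr p) \<partial>mu n) < \<infinity>"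
    using nn_integral_mu_powr[of "\<lambda>_. 1"] by (simp add: bergman_space_iff)
  then show "emeasure (mu n) (space (mu n)) \<noteq> \<infinity>" by simp
qed

text \<open>If the integrals stayed above \<open>e\<close> along points \<open>a k\<close> tending to the circle, compactness applied to
the test functions at \<open>a k\<close> would give a subsequence along which they tend to \<open>0\<close>, by
\<open>nn_integral_powr_tendsto_zero_limit\<close>.\<close>

lemma berezin_vanishes_if_compact:
  assumes comp: "Lp_compact_operator p (Omega \<sigma>) (bergman_space p \<sigma>) (power_op n)" and s: "2 < s"
  shows "((\<lambda>a. \<integral>\<^sup>+w. ennreal (berezin_density s a w) \<partial>mu n) \<longlongrightarrow> 0) to_unit_circle"
proof (rule ccontr)
  assume "\<not> ?thesis"
  then obtain e where e: "0 < e" and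
    not_ev: "\<not> (\<forall>\<^sub>F a in to_unit_circle. (\<integral>\<^sup>+w. ennreal (berezin_density s a w) \<partial>mu n) \<le> ennreal e)"
    unfolding tendsto_zero_ennreal_iff by blast
  have "\<exists>a. 1 - 1 / (real k + 2) < cmod a \<and> cmod a < 1 \<and>
      \<not> (\<integral>\<^sup>+w. ennreal (berezin_density s a w) \<partial>mu n) \<le> ennreal e" for k
  proof (rule ccontr)
    assume neg: "\<not> ?thesis"
    have "\<forall>\<^sub>F a in to_unit_circle. (\<integral>\<^sup>+w. ennreal (berezin_density s a w) \<partial>mu n) \<le> ennreal e"
      unfolding eventually_to_unit_circle using neg by (intro exI[of _ "1 - 1 / (real k + 2)"]) auto
    then show False using not_ev by blast
  qed
  then obtain a where a: "\<And>k. 1 - 1 / (real k + 2) < cmod (a k)" "\<And>k. cmod (a k) < 1"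
    and big: "\<And>k. \<not> (\<integral>\<^sup>+w. ennreal (berezin_density s (a k) w) \<partial>mu n) \<le> ennreal e"
    by metis
  have a2: "1 / 2 \<le> cmod (a k)" for k
  proof -
    have "1 / (real k + 2) \<le> 1 / 2" by (intro divide_left_mono) auto
    then show ?thesis using a(1)[of k] by linarith
  qed
  have alim: "(\<lambda>k. 1 - cmod (a k)) \<longlonglongrightarrow> 0"
  proof (rule Lim_null_comparison)
    show "\<forall>\<^sub>F k in sequentially. norm (1 - cmod (a k)) \<le> 1 / real (k + 2)"
    proof (rule always_eventually, rule allI)
      fix k show "norm (1 - cmod (a k)) \<le> 1 / real (k + 2)" using a(1)[of k] a(2)[of k] by (simp add: add.commute)
    qed
    show "(\<lambda>k. 1 / real (k + 2)) \<longlonglongrightarrow> 0"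
      using LIMSEQ_ignore_initial_segment[OF lim_1_over_n, of 2] by simp
  qed
  define F where "F k = test_function s p (a k)" for k
  define C where "C = 16 / (1 - 2 powr (2 - s))"
  have hol: "F k holomorphic_on unit_disc" for k
    unfolding F_def using test_function_holomorphic a by blast
  have FC: "(\<integral>\<^sup>+z. ennreal (cmod (F k z) powr p) \<partial>dA) \<le> ennreal C" for k
    unfolding F_def C_def norm_test_function_powr[OF p_pos]
    using berezin_density_integral_bound[OF s a2 a(2)] .
  have FX: "F k \<in> bergman_space p \<sigma>" for k using bergman_spaceI(1)[OF hol FC] .
  have "Lp_norm p (Omega \<sigma>) (F k) \<le> (S * C) powr (1 / p)" for k
  proof -
    have FL: "F k \<in> Lp_space p (Omega \<sigma>)" using FX by (simp add: bergman_space_def)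
    have "2 powr (2 - s) < (2::real) powr 0" using s by (intro powr_less_mono) auto
    then have SC: "0 \<le> S * C" using S_pos by (simp add: C_def)
    have "ennreal (Lp_norm p (Omega \<sigma>) (F k) powr p) \<le> ennreal (S * C)"
      using bergman_spaceI(2)[OF hol FC] Lp_norm_powr[OF FL p_pos] by metis
    then have "Lp_norm p (Omega \<sigma>) (F k) powr p \<le> S * C" using SC by simp
    then have "(Lp_norm p (Omega \<sigma>) (F k) powr p) powr (1 / p) \<le> (S * C) powr (1 / p)"
      using p_pos by (intro powr_mono2) auto
    then show ?thesis using p_pos by (simp add: powr_powr Lp_norm_nonneg)
  qed
  then have "\<exists>g\<in>Lp_space p (Omega \<sigma>). \<exists>r. strict_mono r \<and>
      (\<lambda>k. Lp_norm p (Omega \<sigma>) (\<lambda>x. power_op n (F (r k)) x - g x)) \<longlonglongrightarrow> 0"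
    using comp FX unfolding Lp_compact_operator_def by blast
  then obtain g r where g: "g \<in> Lp_space p (Omega \<sigma>)" and r: "strict_mono r"
    and lim: "(\<lambda>k. Lp_norm p (Omega \<sigma>) (\<lambda>x. power_op n (F (r k)) x - g x)) \<longlonglongrightarrow> 0"
    by blast
  have TF: "power_op n (F k) \<in> Lp_space p (Omega \<sigma>)" for k
    using power_op_bergman[OF FX] by (simp add: bergman_space_def)
  have "(\<lambda>k. \<integral>\<^sup>+x. ennreal (cmod (power_op n (F (r k)) x) powr p) \<partial>Omega \<sigma>) \<longlonglongrightarrow> 0"
  proof (rule nn_integral_powr_tendsto_zero_limit[OF p_pos])
    show "power_op n (F (r k)) \<in> borel_measurable (Omega \<sigma>)" for k using TF Lp_space_iff by blast
    show "g \<in> borel_measurable (Omega \<sigma>)" using g Lp_space_iff by blast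
    show "(\<lambda>k. \<integral>\<^sup>+x. ennreal (cmod (power_op n (F (r k)) x - g x) powr p) \<partial>Omega \<sigma>) \<longlonglongrightarrow> 0"
      using lim Lp_norm_tendsto_zero_iff[OF Lp_space_diff[OF p_pos TF g] p_pos] by blast
    fix x assume "x \<in> space (Omega \<sigma>)"
    then have "cmod ((\<phi> ^^ n) x) < 1" using phi_funpow_disc[of x n] by simp
    then have "(\<lambda>k. F k ((\<phi> ^^ n) x)) \<longlonglongrightarrow> 0"
      unfolding F_def using test_function_tendsto_zero[OF a(2) alim s p_pos] by blast
    then have "(\<lambda>k. F (r k) ((\<phi> ^^ n) x)) \<longlonglongrightarrow> 0"
      using LIMSEQ_subseq_LIMSEQ[OF _ r] by (simp add: comp_def)
    then show "(\<lambda>k. power_op n (F (r k)) x) \<longlonglongrightarrow> 0"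
      unfolding weighted_comp_funpow by (rule tendsto_mult_right_zero)
  qed
  then have "(\<lambda>k. \<integral>\<^sup>+w. ennreal (berezin_density s (a (r k)) w) \<partial>mu n) \<longlonglongrightarrow> 0"
    unfolding nn_integral_mu_powr[OF hol, symmetric] unfolding F_def norm_test_function_powr[OF p_pos] .
  then have "\<forall>\<^sub>F k in sequentially. (\<integral>\<^sup>+w. ennreal (berezin_density s (a (r k)) w) \<partial>mu n) \<le> ennreal e"
    using e unfolding tendsto_zero_ennreal_iff by blast
  then have "\<forall>\<^sub>F k::nat in sequentially. False" by (rule eventually_mono) (use big in blast)
  then show False by simp
qed

text \<open>Montel's theorem provides a locally uniform limit \<open>h\<close> of a subsequence, which by Fatou belongs to
the Bergman space. The differences from \<open>h\<close> are bounded in norm and tend to \<open>0\<close> locally uniformly,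
so \<open>vanishing_on_discs_tendsto\<close> applies to them.\<close>

lemma compact_if_vanishing_on_discs:
  assumes van: "vanishing_on_discs (mu n) R" and R: "0 < R" "R < 1"
  shows "Lp_compact_operator p (Omega \<sigma>) (bergman_space p \<sigma>) (power_op n)"
  unfolding Lp_compact_operator_def
proof (intro conjI ballI allI impI)
  fix f assume "f \<in> bergman_space p \<sigma>"
  then show "power_op n f \<in> Lp_space p (Omega \<sigma>)"
    using power_op_bergman by (simp add: bergman_space_def)
next
  fix F :: "nat \<Rightarrow> complex \<Rightarrow> complex"
  assume "(\<forall>k. F k \<in> bergman_space p \<sigma>) \<and> (\<exists>B. \<forall>k. Lp_norm p (Omega \<sigma>) (F k) \<le> B)"
  then obtain B0 where FX: "\<And>k. F k \<in> bergman_space p \<sigma>" and B0: "\<And>k. Lp_norm p (Omega \<sigma>) (F k) \<le> B0"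
    by blast
  have hol: "F k holomorphic_on unit_disc" for k using FX by (simp add: bergman_space_def)
  define B where "B = 1 / m * B0 powr p"
  have B0': "0 \<le> B" using m_pos by (simp add: B_def)
  note meas = holomorphic_ennreal_powr_measurable
  have FB: "(\<integral>\<^sup>+z. ennreal (cmod (F k z) powr p) \<partial>dA) \<le> ennreal B" for k
  proof -
    have FL: "F k \<in> Lp_space p (Omega \<sigma>)" using FX by (simp add: bergman_space_def)
    have "(\<integral>\<^sup>+z. ennreal (cmod (F k z) powr p) \<partial>dA)
        \<le> ennreal (1 / m) * ennreal (Lp_norm p (Omega \<sigma>) (F k) powr p)"
      using nn_integral_dA_le[OF meas[OF hol]] Lp_norm_powr[OF FL p_pos] by metis
    also have "\<dots> \<le> ennreal (1 / m) * ennreal (B0 powr p)"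
      using B0 p_pos Lp_norm_nonneg by (intro mult_left_mono ennreal_leI powr_mono2) auto
    also have "\<dots> = ennreal B" unfolding B_def by (rule ennreal_mult[symmetric]) (use m_pos in auto)
    finally show ?thesis .
  qed
  obtain h r where h: "h holomorphic_on unit_disc" and r: "strict_mono (r :: nat \<Rightarrow> nat)"
    and pt: "\<And>x. x \<in> unit_disc \<Longrightarrow> ((\<lambda>k. F (r k) x) \<longlongrightarrow> h x) sequentially"
    and unif: "\<And>K. compact K \<Longrightarrow> K \<subseteq> unit_disc \<Longrightarrow> uniform_limit K (F \<circ> r) h sequentially"
  proof (rule Montel[of unit_disc "range F" F])
    show "open unit_disc" by simp
    show "f holomorphic_on unit_disc" if "f \<in> range F" for f using that hol by blast
    fix K :: "complex set" assume K: "compact K" "K \<subseteq> unit_disc"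
    let ?b = "\<lambda>w. (submean_const p * B / (1 - cmod w)\<^sup>2) powr (1 / p)"
    have "continuous_on K ?b"
      using K(2) p_pos B0' submean_const_pos[of p]
      by (intro continuous_on_powr' continuous_intros) (auto simp: subset_iff)
    then have "bounded (?b ` K)" using K(1) by (intro compact_imp_bounded compact_continuous_image)
    then obtain c where c: "\<And>w. w \<in> K \<Longrightarrow> norm (?b w) \<le> c" unfolding bounded_iff by blast
    show "\<exists>c. \<forall>f\<in>range F. \<forall>z\<in>K. cmod (f z) \<le> c"
    proof (intro exI[of _ c] ballI)
      fix f w assume f: "f \<in> range F" and w: "w \<in> K"
      then obtain k where k: "f = F k" by blast
      have "cmod (F k w) \<le> ?b w"
        using K(2) w by (intro holomorphic_pointwise_bound[OF hol p_pos _ FB B0']) auto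
      also have "\<dots> \<le> c" using c[OF w] by simp
      finally show "cmod (f w) \<le> c" using k by simp
    qed
  qed auto
  have hB: "(\<integral>\<^sup>+z. ennreal (cmod (h z) powr p) \<partial>dA) \<le> ennreal B"
  proof -
    have "(\<integral>\<^sup>+z. ennreal (cmod (h z) powr p) \<partial>dA)
        = (\<integral>\<^sup>+z. liminf (\<lambda>k. ennreal (cmod (F (r k) z) powr p)) \<partial>dA)"
    proof (rule nn_integral_cong)
      fix z assume "z \<in> space dA"
      then have "(\<lambda>k. cmod (F (r k) z)) \<longlonglongrightarrow> cmod (h z)" by (intro tendsto_intros pt) simp
      then have "(\<lambda>k. ennreal (cmod (F (r k) z) powr p)) \<longlonglongrightarrow> ennreal (cmod (h z) powr p)"
        using p_pos by (intro tendsto_ennrealI tendsto_powr') auto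
      then show "ennreal (cmod (h z) powr p) = liminf (\<lambda>k. ennreal (cmod (F (r k) z) powr p))"
        by (intro lim_imp_Liminf[symmetric]) auto
    qed
    also have "\<dots> \<le> liminf (\<lambda>k. \<integral>\<^sup>+z. ennreal (cmod (F (r k) z) powr p) \<partial>dA)"
      using meas[OF hol] by (rule nn_integral_liminf)
    also have "\<dots> \<le> liminf (\<lambda>k::nat. ennreal B)"
      using FB by (intro Liminf_mono always_eventually allI)
    also have "\<dots> = ennreal B" by (simp add: Liminf_const)
    finally show ?thesis .
  qed
  have hX: "h \<in> bergman_space p \<sigma>" using bergman_spaceI(1)[OF h hB] .
  define G where "G k = (\<lambda>z. F (r k) z - h z)" for k
  have Ghol: "G k holomorphic_on unit_disc" for k
    unfolding G_def by (intro holomorphic_intros hol h)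
  have GB: "(\<integral>\<^sup>+z. ennreal (cmod (G k z) powr p) \<partial>dA) \<le> ennreal (2 powr p * (B + B))" for k
  proof -
    have "(\<integral>\<^sup>+z. ennreal (cmod (G k z) powr p) \<partial>dA) \<le> ennreal (2 powr p) *
        ((\<integral>\<^sup>+z. ennreal (cmod (F (r k) z) powr p) \<partial>dA) + (\<integral>\<^sup>+z. ennreal (cmod (h z) powr p) \<partial>dA))"
      unfolding G_def
      by (intro nn_integral_powr_norm_diff_le[OF p_pos] holomorphic_measurable_dA hol h)
    also have "\<dots> \<le> ennreal (2 powr p) * (ennreal B + ennreal B)"
      by (intro mult_left_mono add_mono FB hB) simp
    also have "\<dots> = ennreal (2 powr p * (B + B))"
      using B0' by (simp only: ennreal_plus ennreal_mult' powr_ge_zero)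
    finally show ?thesis .
  qed
  have "(\<lambda>k. \<integral>\<^sup>+w. ennreal (cmod (G k w) powr p) \<partial>mu n) \<longlonglongrightarrow> 0"
  proof (rule vanishing_on_discs_tendsto[OF finite_mu sets_mu van R p_pos Ghol GB])
    show "0 \<le> 2 powr p * (B + B)" using B0' by simp
    fix K :: "complex set" assume "compact K" "K \<subseteq> unit_disc"
    from unif[OF this] show "uniform_limit K G (\<lambda>_. 0) sequentially"
      unfolding uniform_limit_iff G_def by (simp add: dist_norm)
  qed
  then have lim: "(\<lambda>k. \<integral>\<^sup>+z. ennreal (cmod (power_op n (F (r k)) z - power_op n h z) powr p) \<partial>Omega \<sigma>) \<longlonglongrightarrow> 0"
    unfolding nn_integral_mu_powr[OF Ghol] by (simp add: weighted_comp_funpow G_def right_diff_distrib)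
  have TL: "power_op n f \<in> Lp_space p (Omega \<sigma>)" if "f \<in> bergman_space p \<sigma>" for f
    using power_op_bergman[OF that] by (simp add: bergman_space_def)
  have "(\<lambda>k. Lp_norm p (Omega \<sigma>) (\<lambda>x. power_op n (F (r k)) x - power_op n h x)) \<longlonglongrightarrow> 0"
    using lim Lp_norm_tendsto_zero_iff[OF Lp_space_diff[OF p_pos TL[OF FX] TL[OF hX]] p_pos] by blast
  then show "\<exists>g\<in>Lp_space p (Omega \<sigma>). \<exists>s. strict_mono s \<and>
      (\<lambda>k. Lp_norm p (Omega \<sigma>) (\<lambda>x. power_op n (F (s k)) x - g x)) \<longlonglongrightarrow> 0"
    using TL[OF hX] r by blast
qed

abbreviation "compact_power n \<equiv> Lp_compact_operator p (Omega \<sigma>) (bergman_space p \<sigma>) (power_op n)"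

text \<open>The Berezin condition is used as an intermediate step and may be taken at any exponent above \<open>2\<close>.
Since the left-hand side is independent of \<open>R\<close>, vanishing on discs of one radius implies it for all.\<close>

lemma compact_power_iff_vanishing:
  assumes "0 < R" "R < 1"
  shows "compact_power n \<longleftrightarrow> vanishing_on_discs (mu n) R"
  using compact_if_vanishing_on_discs[OF _ assms]
    vanishing_on_discs_if_berezin[OF sets_mu _ assms, of 3] berezin_vanishes_if_compact[of n 3] by auto

lemma compact_power_iff_berezin:
  assumes t: "2 < (\<alpha> + 2) * t"
  shows "compact_power n \<longleftrightarrow> ((\<lambda>z. berezin \<alpha> t (mu n) z /
      ennreal (\<sigma> (cmod z) * (1 - (cmod z)\<^sup>2) powr (2 - (\<alpha> + 2) * t / 2))) \<longlongrightarrow> 0) to_unit_circle"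
  unfolding berezin_tendsto_iff[OF sets_mu less_imp_le[OF t] m_pos bounds]
  using berezin_vanishes_if_compact[OF _ t, of n]
    compact_if_vanishing_on_discs[of n "1 / 2"] vanishing_on_discs_if_berezin[OF sets_mu, of "(\<alpha> + 2) * t" "1 / 2" n] t by auto

lemma compact_power_iff_averaging:
  assumes R: "0 < R" "R < 1"
  shows "compact_power n \<longleftrightarrow>
    ((\<lambda>z. averaging R (mu n) z / ennreal (\<sigma> (cmod z))) \<longlongrightarrow> 0) to_unit_circle"
proof -
  have "\<forall>\<^sub>F z in to_unit_circle. cmod z < 1"
    unfolding eventually_to_unit_circle by (intro exI[of _ 0]) auto
  from averaging_tendsto_iff[OF sets_mu R m_pos bounds, of "\<lambda>z. z", OF this]
  show ?thesis unfolding compact_power_iff_vanishing[OF R] vanishing_on_discs_altdef by simp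
qed

lemma compact_power_iff_lattice:
  assumes r: "0 < r" "r < 1" and lat: "lattice_seq r z"
  shows "compact_power n \<longleftrightarrow>
    (\<lambda>k. averaging r (mu n) (z k) / ennreal (\<sigma> (cmod (z k)))) \<longlonglongrightarrow> 0"
proof
  assume "compact_power n"
  then show "(\<lambda>k. averaging r (mu n) (z k) / ennreal (\<sigma> (cmod (z k)))) \<longlonglongrightarrow> 0"
    unfolding compact_power_iff_averaging[OF r]
    using filterlim_compose[OF _ lattice_seq_to_unit_circle[OF lat r]] by blast
next
  assume lim: "(\<lambda>k. averaging r (mu n) (z k) / ennreal (\<sigma> (cmod (z k)))) \<longlonglongrightarrow> 0"
  have "\<forall>\<^sub>F k in sequentially. cmod (z k) < 1"
    using lattice_seq_in_disc[OF lat] by simp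
  from averaging_tendsto_iff[OF sets_mu r m_pos bounds, of z, OF this] lim
  have "\<forall>\<epsilon>>0. \<forall>\<^sub>F k in sequentially.
      emeasure (mu n) (pseudohyperbolic_disc (z k) r) \<le> ennreal (\<epsilon> * (1 - cmod (z k))\<^sup>2)"
    by simp
  then have "vanishing_on_discs (mu n) r"
    by (intro lattice_vanishing_on_discs[OF sets_mu lat r r]) blast
  then show "compact_power n" using compact_power_iff_vanishing[OF r] by blast
qed

end

theorem corollary2:
  fixes \<sigma> :: "real \<Rightarrow> real" and \<alpha> p t :: real and \<psi> \<phi> :: "complex \<Rightarrow> complex"
  assumes "admissible_weight \<sigma>"
    and "\<alpha> > -1" and "0 < p" and "t > 2 / (\<alpha> + 2)"
    and "\<psi> holomorphic_on unit_disc"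
    and "\<phi> holomorphic_on unit_disc" and "\<phi> ` unit_disc \<subseteq> unit_disc"
    and "Lp_bounded_operator p (Omega \<sigma>) (bergman_space p \<sigma>) (weighted_comp \<psi> \<phi>)"
  shows
    "(power_compact p \<sigma> \<psi> \<phi> \<longleftrightarrow>
        (\<exists>n\<ge>1. ((\<lambda>z. berezin \<alpha> t (Omega_n p \<sigma> \<psi> \<phi> n) z /
            ennreal (\<sigma> (cmod z) * (1 - (cmod z)\<^sup>2) powr (2 - (\<alpha> + 2) * t / 2))) \<longlongrightarrow> 0)
          to_unit_circle)) \<and>
     (power_compact p \<sigma> \<psi> \<phi> \<longleftrightarrow>
        (\<exists>n\<ge>1. \<exists>R\<in>{0<..<1}.
          ((\<lambda>z. averaging R (Omega_n p \<sigma> \<psi> \<phi> n) z / ennreal (\<sigma> (cmod z))) \<longlongrightarrow> 0)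
          to_unit_circle)) \<and>
     (power_compact p \<sigma> \<psi> \<phi> \<longleftrightarrow>
        (\<exists>n\<ge>1. \<exists>r\<in>{0<..<1}. \<exists>z. lattice_seq r z \<and>
          (\<lambda>k. averaging r (Omega_n p \<sigma> \<psi> \<phi> n) (z k) / ennreal (\<sigma> (cmod (z k)))) \<longlonglongrightarrow> 0)) \<and>
     (\<forall>n\<ge>1.
        (\<exists>R\<in>{0<..<1}.
          ((\<lambda>z. averaging R (Omega_n p \<sigma> \<psi> \<phi> n) z / ennreal (\<sigma> (cmod z))) \<longlongrightarrow> 0)
          to_unit_circle) \<longleftrightarrow>
        (\<forall>R\<in>{0<..<1}.
          ((\<lambda>z. averaging R (Omega_n p \<sigma> \<psi> \<phi> n) z / ennreal (\<sigma> (cmod z))) \<longlongrightarrow> 0)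
          to_unit_circle)) \<and>
     (\<forall>n\<ge>1.
        (\<exists>r\<in>{0<..<1}. \<exists>z. lattice_seq r z \<and>
          (\<lambda>k. averaging r (Omega_n p \<sigma> \<psi> \<phi> n) (z k) / ennreal (\<sigma> (cmod (z k)))) \<longlonglongrightarrow> 0) \<longleftrightarrow>
        (\<forall>r\<in>{0<..<1}. \<forall>z. lattice_seq r z \<longrightarrow>
          (\<lambda>k. averaging r (Omega_n p \<sigma> \<psi> \<phi> n) (z k) / ennreal (\<sigma> (cmod (z k)))) \<longlonglongrightarrow> 0))"
proof -
  obtain m S where mS: "0 < m" "\<forall>x\<in>{0..1}. m \<le> \<sigma> x \<and> \<sigma> x \<le> S" "continuous_on {0..1} \<sigma>"
    using admissible_weight_bounds[OF assms(1)] .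
  interpret weighted_composition \<sigma> m S p \<psi> \<phi>
  proof
    show "weighted_comp \<psi> \<phi> f \<in> Lp_space p (Omega \<sigma>)" if "f \<in> bergman_space p \<sigma>" for f
      using assms(8) that unfolding Lp_bounded_operator_def by blast
  qed (use mS assms in auto)
  have t: "2 < (\<alpha> + 2) * t" using assms(2,4) by (simp add: pos_divide_less_eq mult.commute)
  have b: "compact_power n \<longleftrightarrow> ((\<lambda>z. berezin \<alpha> t (mu n) z /
      ennreal (\<sigma> (cmod z) * (1 - (cmod z)\<^sup>2) powr (2 - (\<alpha> + 2) * t / 2))) \<longlongrightarrow> 0) to_unit_circle" for n
    by (rule compact_power_iff_berezin[OF t])
  have c: "((\<lambda>z. averaging R (mu n) z / ennreal (\<sigma> (cmod z))) \<longlongrightarrow> 0) to_unit_circle \<longleftrightarrow> compact_power n"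
    if "R \<in> {0<..<1}" for R n
    using that compact_power_iff_averaging[of R n] by simp
  have d: "(\<lambda>k. averaging r (mu n) (z k) / ennreal (\<sigma> (cmod (z k)))) \<longlonglongrightarrow> 0 \<longleftrightarrow> compact_power n"
    if "r \<in> {0<..<1}" "lattice_seq r z" for r z n
    using that compact_power_iff_lattice[of r z n] by simp
  have ex_R: "\<exists>R::real. R \<in> {0<..<1}" by (intro exI[of _ "1 / 2"]) simp
  have ex_lat: "\<exists>r\<in>{0<..<1}. \<exists>z. lattice_seq r z"
    using lattice_seq_exists[of "1 / 2"] by (intro bexI[of _ "1 / 2"]) auto
  have c_ex: "(\<exists>R\<in>{0<..<1}. ((\<lambda>z. averaging R (mu n) z / ennreal (\<sigma> (cmod z))) \<longlongrightarrow> 0) to_unit_circle)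
      \<longleftrightarrow> compact_power n" for n
    using c[of _ n] ex_R by (metis (no_types, lifting))
  have c_all: "(\<forall>R\<in>{0<..<1}. ((\<lambda>z. averaging R (mu n) z / ennreal (\<sigma> (cmod z))) \<longlongrightarrow> 0) to_unit_circle)
      \<longleftrightarrow> compact_power n" for n
    using c[of _ n] ex_R by (metis (no_types, lifting))
  have d_ex: "(\<exists>r\<in>{0<..<1}. \<exists>z. lattice_seq r z \<and>
        (\<lambda>k. averaging r (mu n) (z k) / ennreal (\<sigma> (cmod (z k)))) \<longlonglongrightarrow> 0) \<longleftrightarrow> compact_power n" for n
    using d[of _ _ n] ex_lat by (metis (no_types, lifting))
  have d_all: "(\<forall>r\<in>{0<..<1}. \<forall>z. lattice_seq r z \<longrightarrow>
        (\<lambda>k. averaging r (mu n) (z k) / ennreal (\<sigma> (cmod (z k)))) \<longlonglongrightarrow> 0) \<longleftrightarrow> compact_power n" for n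
    using d[of _ _ n] ex_lat by (metis (no_types, lifting))
  show ?thesis
    unfolding power_compact_def b[symmetric] c_ex c_all d_ex d_all by simp
qed

end
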